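(* Let $0\le\alpha<mn$, let $1<p_1,\dots,p_m<\infty$ with $\frac1p=\frac1{p_1}+\cdots+\frac1{p_m}$, and let $0<p\le q<\infty$. Assume that $\mathscr{B}$ is a Muckenhoupt basis in $\mathbb{R}^n$. If $\vec w=(w_1,\dots,w_m)$ and $v$ are weights such that the condition $(A_{\mathscr{B},\gamma,v})$ holds for some $\gamma\in(0,1)$ and, for some $r>1$, $$\sup_{B\in\mathscr{B}}|B|^{\frac\alpha n+\frac1q-\frac1p}\Big(\frac1{|B|}\int_Bv\,dx\Big)^{\frac1q}\prod_{i=1}^m\Big(\frac1{|B|}\int_Bw_i^{(1-p_i')r}dx\Big)^{\frac1{rp_i'}}<\infty,$$ then $\mathcal{M}_{\mathscr{B},\alpha}$ is bounded from $L^{p_1}(w_1)\times\cdots\times L^{p_m}(w_m)$ to $L^q(v)$; that is, there is $C>0$ such that for all $\vec f=(f_1,\dots,f_m)$, $$\Big(\int_{\mathbb{R}^n}\mathcal{M}_{\mathscr{B},\alpha}(\vec f)^q\,v\,dx\Big)^{1/q}\le C\prod_{i=1}^m\Big(\int_{\mathbb{R}^n}|f_i|^{p_i}w_i\,dx\Big)^{1/p_i}.$$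
   Context: A basis $\mathscr{B}$ in $\mathbb{R}^n$ is a collection of open sets in $\mathbb{R}^n$. A weight associated with $\mathscr{B}$ is a nonnegative measurable function $w$ with $w(B)=\int_Bw\,dx<\infty$ for each $B\in\mathscr{B}$. The maximal operator of the basis is $M_{\mathscr{B}}f(x)=\sup_{B\in\mathscr{B},B\ni x}\frac1{|B|}\int_B|f(y)|dy$. For $1<s<\infty$, $w\in A_{s,\mathscr{B}}$ means $\sup_{B\in\mathscr{B}}\big(\frac1{|B|}\int_Bw\,dx\big)\big(\frac1{|B|}\int_Bw^{1-s'}dx\big)^{s/s'}<\infty$, with $s'=s/(s-1)$. $\mathscr{B}$ is a Muckenhoupt basis if $M_{\mathscr{B}}$ is bounded on $L^s(w)$ for every $1<s<\infty$ and every $w\in A_{s,\mathscr{B}}$. The multilinear fractional maximal operator of the basis is $$\mathcal{M}_{\mathscr{B},\alpha}(\vec f)(x)=\sup_{B\in\mathscr{B},B\ni x}|B|^{\frac\alpha n}\prod_{i=1}^m\frac1{|B|}\int_B|f_i(y)|dy .$$ Tauberian condition $(A_{\mathscr{B},\gamma,\mu})$, for $\gamma\in(0,1)$ and a weight $\mu$: there is a positive constant $C_{\mathscr{B},\gamma,\mu}$ such that for all measurable sets $E$, $\mu(\{x\in\mathbb{R}^n:M_{\mathscr{B}}(\mathbf 1_E)(x)>\gamma\})\le C_{\mathscr{B},\gamma,\mu}\,\mu(E)$, where $\mu(E)=\int_E\mu\,dx$. *)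

theory Defs
  imports "HOL-Analysis.Analysis"
begin

text \<open>
  Maximal functions, averages and norms take values in \<open>[0,\<infinity>]\<close>, with the measure-theoretic convention
  \<open>0 \<cdot> \<infinity> = 0\<close> of \<^typ>\<open>ennreal\<close>.  ``Measurable'' is Lebesgue measurable.
\<close>

text \<open>
  Real powers on \<open>[0,\<infinity>]\<close>.  Note that \<open>0 powr a = 0\<close> for real \<open>powr\<close>, whereas a weight that
  vanishes somewhere has to satisfy \<open>w powr (1 - s') = \<infinity>\<close> there.
\<close>

definition epowr :: "ennreal \<Rightarrow> real \<Rightarrow> ennreal" (infixr "epowr" 80) where
  "x epowr a =
     (if a = 0 then 1
      else if x = 0 then (if a > 0 then 0 else \<infinity>)
      else if x = \<infinity> then (if a > 0 then \<infinity> else 0)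
      else ennreal (enn2real x powr a))"

definition conj_exp :: "real \<Rightarrow> real" where
  "conj_exp s = s / (s - 1)"

text \<open>
  That the sets have finite measure is implicit in the averages \<open>1/|B| \<integral>\<^sub>B\<close> (and in the constant
  \<open>1\<close> being a weight).  The empty set is harmless: it contains no point, and its averages
  are \<open>0/0 = 0\<close> in \<^typ>\<open>ennreal\<close>.
\<close>

definition is_basis :: "(real ^ 'n) set set \<Rightarrow> bool" where
  "is_basis \<B> \<longleftrightarrow> (\<forall>B\<in>\<B>. open B \<and> emeasure lebesgue B < \<infinity>)"

definition avg :: "(real ^ 'n) set \<Rightarrow> (real ^ 'n \<Rightarrow> ennreal) \<Rightarrow> ennreal" where
  "avg B g = (\<integral>\<^sup>+x\<in>B. g x \<partial>lebesgue) / emeasure lebesgue B"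

definition wmeas :: "(real ^ 'n \<Rightarrow> real) \<Rightarrow> (real ^ 'n) set \<Rightarrow> ennreal" where
  "wmeas w E = (\<integral>\<^sup>+x\<in>E. ennreal (w x) \<partial>lebesgue)"

definition weight :: "(real ^ 'n) set set \<Rightarrow> (real ^ 'n \<Rightarrow> real) \<Rightarrow> bool" where
  "weight \<B> w \<longleftrightarrow>
     w \<in> borel_measurable lebesgue \<and> (\<forall>x. 0 \<le> w x) \<and> (\<forall>B\<in>\<B>. wmeas w B < \<infinity>)"

definition wnorm :: "real \<Rightarrow> (real ^ 'n \<Rightarrow> real) \<Rightarrow> (real ^ 'n \<Rightarrow> ennreal) \<Rightarrow> ennreal" where
  "wnorm s w g = (\<integral>\<^sup>+x. (g x epowr s) * ennreal (w x) \<partial>lebesgue) epowr (1 / s)"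

definition maximal :: "(real ^ 'n) set set \<Rightarrow> (real ^ 'n \<Rightarrow> real) \<Rightarrow> real ^ 'n \<Rightarrow> ennreal" where
  "maximal \<B> f x = (SUP B\<in>{B\<in>\<B>. x \<in> B}. avg B (\<lambda>y. ennreal \<bar>f y\<bar>))"

definition frac_maximal ::
  "(real ^ 'n) set set \<Rightarrow> real \<Rightarrow> nat \<Rightarrow> (nat \<Rightarrow> real ^ 'n \<Rightarrow> real) \<Rightarrow> real ^ 'n \<Rightarrow> ennreal" where
  "frac_maximal \<B> \<alpha> m f x =
     (SUP B\<in>{B\<in>\<B>. x \<in> B}.
        (emeasure lebesgue B epowr (\<alpha> / real CARD('n))) *
        (\<Prod>i=1..m. avg B (\<lambda>y. ennreal \<bar>f i y\<bar>)))"

definition A_class :: "(real ^ 'n) set set \<Rightarrow> real \<Rightarrow> (real ^ 'n \<Rightarrow> real) \<Rightarrow> bool" where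
  "A_class \<B> s w \<longleftrightarrow> weight \<B> w \<and>
     (SUP B\<in>\<B>. avg B (\<lambda>x. ennreal (w x)) *
        (avg B (\<lambda>x. ennreal (w x) epowr (1 - conj_exp s)) epowr (s / conj_exp s))) < \<infinity>"

definition muckenhoupt_basis :: "(real ^ 'n) set set \<Rightarrow> bool" where
  "muckenhoupt_basis \<B> \<longleftrightarrow> is_basis \<B> \<and>
     (\<forall>s>1. \<forall>w. A_class \<B> s w \<longrightarrow>
        (\<exists>C>0. \<forall>f \<in> borel_measurable lebesgue.
           wnorm s w (maximal \<B> f) \<le> ennreal C * wnorm s w (\<lambda>x. ennreal \<bar>f x\<bar>)))"

definition tauberian :: "(real ^ 'n) set set \<Rightarrow> real \<Rightarrow> (real ^ 'n \<Rightarrow> real) \<Rightarrow> bool" where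
  "tauberian \<B> \<gamma> \<mu> \<longleftrightarrow>
     (\<exists>C>0. \<forall>E \<in> sets lebesgue.
        wmeas \<mu> {x. maximal \<B> (indicator E) x > ennreal \<gamma>} \<le> ennreal C * wmeas \<mu> E)"

end

theory Submission
  imports Defs
begin

text \<open>
  Only finitely many sets of the basis need to be considered (Lindeloef, monotone convergence).
  Order them by decreasing value \<open>c(B) = |B|\<^bsup>\<alpha>/n\<^esup> \<Prod> avg\<^sub>B |f\<^sub>i|\<close> and discard a set when more than the fraction
  \<open>\<gamma>\<close> of it is covered by the sets selected before.  The discarded sets lie where the maximal function
  of the union of the selected ones exceeds \<open>\<gamma>\<close>, so the Tauberian condition and a summation by parts
  give \<open>\<integral> (max c(B) 1\<^sub>B)\<^sup>q v \<le> C \<Sum> c(B)\<^sup>q v(B)\<close> over the selected \<open>B\<close>, each of which has a part \<open>E\<^sub>B\<close>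
  with \<open>|E\<^sub>B| \<ge> (1 - \<gamma>) |B|\<close>, these parts being disjoint.  Hoelder's inequality on \<open>B\<close> and the bump condition
  bound \<open>c(B)\<^sup>q v(B)\<close> by \<open>\<Prod> (|B| (avg\<^sub>B g\<^sub>i)\<^bsup>s\<^sub>i\<^esup>)\<^bsup>q/p\<^sub>i\<^esup>\<close>, where \<open>s\<^sub>i > 1\<close> and \<open>g\<^sub>i\<^bsup>s\<^sub>i\<^esup> = |f\<^sub>i|\<^bsup>p\<^sub>i\<^esup> w\<^sub>i\<close>.
  By Hoelder for sums (here \<open>q \<ge> p\<close> enters) it remains to note
  \<open>(1 - \<gamma>) \<Sum> |B| (avg\<^sub>B g\<^sub>i)\<^bsup>s\<^sub>i\<^esup> \<le> \<integral> (M g\<^sub>i)\<^bsup>s\<^sub>i\<^esup>\<close> and the boundedness of \<open>M\<close> on unweighted \<open>L\<^bsup>s\<^sub>i\<^esup>\<close>, the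
  constant 1 being an \<open>A\<^sub>s\<close> weight.
\<close>

subsection \<open>Powers and Hoelder's inequality in the extended nonnegative reals\<close>

lemma epowr_zero_base [simp]: "0 < a \<Longrightarrow> 0 epowr a = 0"
  by (simp add: epowr_def)

lemma epowr_top_base [simp]: "0 < a \<Longrightarrow> top epowr a = top"
  by (simp add: epowr_def)

lemma epowr_zero_exp [simp]: "x epowr 0 = 1"
  by (simp add: epowr_def)

lemma epowr_one_base [simp]: "1 epowr a = 1"
  by (simp add: epowr_def)

lemma epowr_one_exp [simp]: "x epowr 1 = x"
  by (cases x) (auto simp: epowr_def ennreal_eq_0_iff)

lemma epowr_ennreal: "0 < x \<Longrightarrow> ennreal x epowr a = ennreal (x powr a)"
  by (auto simp: epowr_def)

lemma epowr_ennreal_nonneg: "0 \<le> x \<Longrightarrow> 0 < a \<Longrightarrow> ennreal x epowr a = ennreal (x powr a)"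
  by (cases "x = 0") (auto simp: epowr_ennreal)

lemma ennreal_cases_pos:
  obtains (zero) "x = 0" | (top) "x = top" | (pos) r where "0 < r" "x = ennreal r"
  by (cases x) (auto, metis ennreal_0 less_eq_real_def)

lemma epowr_eq_0_iff [simp]: "0 < a \<Longrightarrow> x epowr a = 0 \<longleftrightarrow> x = 0"
  by (cases x rule: ennreal_cases_pos) (auto simp: epowr_ennreal)

lemma epowr_eq_top_iff [simp]: "0 < a \<Longrightarrow> x epowr a = top \<longleftrightarrow> x = top"
  by (cases x rule: ennreal_cases_pos) (auto simp: epowr_ennreal)

lemma epowr_mono:
  assumes "x \<le> y" "0 \<le> a" shows "x epowr a \<le> y epowr a"
proof (cases "a = 0")
  case False
  then show ?thesis
    using assms
    by (cases x rule: ennreal_cases_pos; cases y rule: ennreal_cases_pos)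
       (auto simp: epowr_ennreal top_unique intro!: ennreal_leI powr_mono2)
qed simp

text \<open>A negative exponent has to be excluded: at \<open>x = 0\<close>, \<open>y = top\<close>
  the left side would be \<open>top\<close> and the right side \<open>0\<close>, because
  \<open>0 * top = 0\<close>.\<close>

lemma epowr_mult:
  assumes "0 \<le> a" shows "(x * y) epowr a = x epowr a * y epowr a"
proof (cases "a = 0")
  case False
  then have "0 < a" using assms by simp
  then show ?thesis
    by (cases x rule: ennreal_cases_pos; cases y rule: ennreal_cases_pos)
       (auto simp: epowr_ennreal ennreal_mult_top ennreal_top_mult powr_mult
             simp flip: ennreal_mult'')
qed simp

lemma epowr_prod:
  assumes "0 \<le> a" shows "(\<Prod>i\<in>I. f i) epowr a = (\<Prod>i\<in>I. f i epowr a)"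
  by (induction I rule: infinite_finite_induct) (auto simp: epowr_mult assms)

lemma epowr_epowr:
  assumes "0 \<le> a" "0 \<le> b" shows "(x epowr a) epowr b = x epowr (a * b)"
proof (cases "a = 0 \<or> b = 0")
  case False
  then show ?thesis using assms
    by (cases x rule: ennreal_cases_pos) (auto simp: epowr_ennreal powr_powr)
qed auto

lemma epowr_add:
  assumes "x \<noteq> 0" "x \<noteq> top" shows "x epowr (a + b) = x epowr a * x epowr b"
  using assms
  by (cases x rule: ennreal_cases_pos) (auto simp: epowr_ennreal powr_add ennreal_mult)

lemma epowr_add_nonneg:
  assumes "0 \<le> a" "0 \<le> b" shows "x epowr (a + b) = x epowr a * x epowr b"
proof (cases "a = 0 \<or> b = 0")
  case False
  then show ?thesis using assms
    by (cases x rule: ennreal_cases_pos) (auto simp: epowr_ennreal powr_add ennreal_mult)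
qed auto

lemma epowr_sum:
  assumes "x \<noteq> 0" "x \<noteq> top"
  shows "x epowr (\<Sum>i\<in>I. a i) = (\<Prod>i\<in>I. x epowr a i)"
  by (induction I rule: infinite_finite_induct) (auto simp: epowr_add assms)

text \<open>The powers \<open>a\<close> and \<open>1 / a\<close> are mutually inverse order
  isomorphisms of [0, \<infinity>]; in this form a power can be moved past a supremum.\<close>

lemma epowr_le_iff:
  assumes "0 < a" shows "x epowr a \<le> y \<longleftrightarrow> x \<le> y epowr (1 / a)"
proof
  assume "x epowr a \<le> y"
  from epowr_mono[OF this, of "1 / a"] show "x \<le> y epowr (1 / a)"
    using assms by (simp add: epowr_epowr)
next
  assume "x \<le> y epowr (1 / a)"
  from epowr_mono[OF this, of a] show "x epowr a \<le> y"
    using assms by (simp add: epowr_epowr)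
qed

lemma measurable_epowr [measurable (raw)]:
  assumes [measurable]: "f \<in> borel_measurable M"
  shows "(\<lambda>x. f x epowr a) \<in> borel_measurable M"
  unfolding epowr_def by measurable

text \<open>Write \<open>x epowr a\<close> as \<open>x epowr (a - 1) * x\<close>: in each term the
  first factor only grows when its base is replaced by the whole sum.\<close>

lemma sum_epowr_le:
  assumes "finite I" "1 \<le> a"
  shows "(\<Sum>i\<in>I. f i epowr a) \<le> (\<Sum>i\<in>I. f i) epowr a"
  using assms(1)
proof (induction I rule: finite_induct)
  case (insert j I)
  have split: "x epowr a = x epowr (a - 1) * x" for x
    using epowr_add_nonneg[of "a - 1" 1 x] assms(2) by simp
  have "f j epowr a + (\<Sum>i\<in>I. f i) epowr a
      \<le> (f j + (\<Sum>i\<in>I. f i)) epowr (a - 1) * f j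
        + (f j + (\<Sum>i\<in>I. f i)) epowr (a - 1) * (\<Sum>i\<in>I. f i)"
    unfolding split[of "f j"] split[of "\<Sum>i\<in>I. f i"]
    using assms(2) by (intro add_mono mult_right_mono epowr_mono) auto
  also have "\<dots> = (f j + (\<Sum>i\<in>I. f i)) epowr a"
    unfolding split[of "f j + (\<Sum>i\<in>I. f i)"] by (simp add: distrib_left)
  finally show ?case
    using insert by (auto intro: order_trans add_left_mono)
qed simp

section \<open>The weighted mean inequality and Hoelder's inequality for several factors\<close>

lemma weighted_arith_geom_mean:
  fixes x a :: "'i \<Rightarrow> real"
  assumes "finite I" "\<And>i. i \<in> I \<Longrightarrow> 0 < x i" "\<And>i. i \<in> I \<Longrightarrow> 0 < a i" "(\<Sum>i\<in>I. a i) = 1"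
  shows "(\<Prod>i\<in>I. x i powr a i) \<le> (\<Sum>i\<in>I. a i * x i)"
proof -
  have ne: "I \<noteq> {}" using assms(4) by auto
  have pos: "0 < (\<Sum>i\<in>I. a i * x i)"
    using assms ne by (intro sum_pos mult_pos_pos) auto
  have "(\<Sum>i\<in>I. a i * ln (x i)) \<le> ln (\<Sum>i\<in>I. a i *\<^sub>R x i)"
    using assms ne by (intro concave_on_sum[OF _ _ ln_concave]) (auto intro: less_imp_le)
  then have "exp (\<Sum>i\<in>I. a i * ln (x i)) \<le> (\<Sum>i\<in>I. a i * x i)"
    using pos by (simp add: ln_ge_iff)
  also have "exp (\<Sum>i\<in>I. a i * ln (x i)) = (\<Prod>i\<in>I. x i powr a i)"
    using assms by (auto simp: exp_sum powr_def intro!: prod.cong dest: assms(2))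
  finally show ?thesis .
qed

lemma weighted_arith_geom_mean_ennreal:
  assumes "finite I" "\<And>i. i \<in> I \<Longrightarrow> 0 < a i" "(\<Sum>i\<in>I. a i) = 1"
  shows "(\<Prod>i\<in>I. x i epowr a i) \<le> (\<Sum>i\<in>I. ennreal (a i) * x i)"
proof -
  \<comment> \<open>A vanishing factor is treated first, since it makes the product zero even next
    to an infinite factor.\<close>
  consider "\<exists>i\<in>I. x i = 0" | i where "i \<in> I" "x i = top" | "\<forall>i\<in>I. x i \<noteq> 0 \<and> x i \<noteq> top"
    by blast
  then show ?thesis
  proof cases
    case 1
    then have "(\<Prod>i\<in>I. x i epowr a i) = 0" using assms by auto
    then show ?thesis by (metis zero_le)
  next
    case 2
    have "top = ennreal (a i) * x i"
      using 2 assms by (simp add: ennreal_mult_top ennreal_eq_0_iff not_le)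
    also have "\<dots> \<le> (\<Sum>i\<in>I. ennreal (a i) * x i)"
      using 2 assms by (intro member_le_sum) auto
    finally show ?thesis by (simp add: top_unique)
  next
    case 3
    define y where "y i = enn2real (x i)" for i
    have y: "0 < y i" "x i = ennreal (y i)" if "i \<in> I" for i
      using 3 that unfolding y_def
      by (auto simp: enn2real_positive_iff less_top zero_less_iff_neq_zero)
    have "(\<Prod>i\<in>I. x i epowr a i) = (\<Prod>i\<in>I. ennreal (y i powr a i))"
      using y by (intro prod.cong) (auto simp: epowr_ennreal)
    also have "\<dots> = ennreal (\<Prod>i\<in>I. y i powr a i)"
      by (intro prod_ennreal) auto
    also have "\<dots> \<le> ennreal (\<Sum>i\<in>I. a i * y i)"
      using assms y by (intro ennreal_leI weighted_arith_geom_mean) auto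
    also have "\<dots> = (\<Sum>i\<in>I. ennreal (a i * y i))"
      using assms y by (intro sum_ennreal[symmetric]) (auto intro: mult_nonneg_nonneg less_imp_le)
    also have "\<dots> = (\<Sum>i\<in>I. ennreal (a i) * x i)"
      using assms y by (intro sum.cong) (auto simp: ennreal_mult less_imp_le)
    finally show ?thesis .
  qed
qed

text \<open>After division of each \<open>f i\<close> by its integral, the weighted mean inequality
  holds pointwise, and its right side integrates to the sum of the weights, which is 1.\<close>

lemma nn_integral_prod_epowr_le:
  assumes "finite I" "\<And>i. i \<in> I \<Longrightarrow> 0 < a i" "(\<Sum>i\<in>I. a i) = 1"
    and meas: "\<And>i. i \<in> I \<Longrightarrow> f i \<in> borel_measurable M"
  shows "(\<integral>\<^sup>+x. (\<Prod>i\<in>I. f i x epowr a i) \<partial>M) \<le> (\<Prod>i\<in>I. (\<integral>\<^sup>+x. f i x \<partial>M) epowr a i)"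
proof -
  define N where "N i = (\<integral>\<^sup>+x. f i x \<partial>M)" for i
  \<comment> \<open>If one integral vanishes, the integrand is zero almost everywhere, even where
    other functions are infinite. Only when none vanishes does an infinite integral make the right
    side infinite.\<close>
  consider i where "i \<in> I" "N i = 0" | i where "i \<in> I" "N i = top" "\<forall>i\<in>I. N i \<noteq> 0"
    | "\<forall>i\<in>I. N i \<noteq> 0 \<and> N i \<noteq> top" by blast
  then show ?thesis
  proof cases
    case 1
    have "AE x in M. f i x = 0"
      using 1 meas by (simp add: N_def nn_integral_0_iff_AE)
    then have "(\<integral>\<^sup>+x. (\<Prod>i\<in>I. f i x epowr a i) \<partial>M) = (\<integral>\<^sup>+x. 0 \<partial>M)"
      using 1 assms by (intro nn_integral_cong_AE) auto
    then show ?thesis by simp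
  next
    case 2
    have "(\<Prod>i\<in>I. N i epowr a i) = top"
      using 2 assms by (auto simp: ennreal_prod_eq_top)
    then show ?thesis by (simp add: N_def)
  next
    case 3
    have "(\<integral>\<^sup>+x. (\<Prod>i\<in>I. f i x epowr a i) \<partial>M)
       \<le> (\<integral>\<^sup>+x. (\<Prod>i\<in>I. N i epowr a i) * (\<Sum>i\<in>I. ennreal (a i) / N i * f i x) \<partial>M)"
    proof (rule nn_integral_mono)
      fix x
      have "f i x = N i * (f i x / N i)" if "i \<in> I" for i
        using 3 that by (simp add: ennreal_times_divide mult_divide_eq_ennreal mult.commute[of "N i"])
      then have "f i x epowr a i = N i epowr a i * (f i x / N i) epowr a i" if "i \<in> I" for i
        using that assms(2) by (metis epowr_mult less_imp_le)
      then have "(\<Prod>i\<in>I. f i x epowr a i) = (\<Prod>i\<in>I. N i epowr a i) * (\<Prod>i\<in>I. (f i x / N i) epowr a i)"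
        by (simp add: prod.distrib)
      also have "\<dots> \<le> (\<Prod>i\<in>I. N i epowr a i) * (\<Sum>i\<in>I. ennreal (a i) * (f i x / N i))"
        using assms by (intro mult_left_mono weighted_arith_geom_mean_ennreal) auto
      finally show "(\<Prod>i\<in>I. f i x epowr a i)
          \<le> (\<Prod>i\<in>I. N i epowr a i) * (\<Sum>i\<in>I. ennreal (a i) / N i * f i x)"
        by (simp add: divide_ennreal_def ac_simps)
    qed
    also have "\<dots> = (\<Prod>i\<in>I. N i epowr a i) * (\<Sum>i\<in>I. ennreal (a i) / N i * N i)"
      using meas by (simp add: nn_integral_cmult nn_integral_sum N_def)
    also have "(\<Sum>i\<in>I. ennreal (a i) / N i * N i) = (\<Sum>i\<in>I. ennreal (a i))"
      using 3 by (intro sum.cong) (auto simp: ennreal_divide_times less_top)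
    also have "\<dots> = 1"
      using assms by (simp add: less_imp_le)
    finally show ?thesis by (simp add: N_def)
  qed
qed

text \<open>With \<open>A\<close> the total of the exponents, Hoelder's inequality for the counting
  measure applies to \<open>a i / A\<close>, and superadditivity of the power
  \<open>A \<ge> 1\<close> does the rest.\<close>

lemma sum_prod_epowr_le:
  assumes "finite I" "finite S" "\<And>i. i \<in> I \<Longrightarrow> 0 < a i" "1 \<le> (\<Sum>i\<in>I. a i)"
  shows "(\<Sum>s\<in>S. \<Prod>i\<in>I. f i s epowr a i) \<le> (\<Prod>i\<in>I. (\<Sum>s\<in>S. f i s) epowr a i)"
proof -
  define A where "A = (\<Sum>i\<in>I. a i)"
  have A: "1 \<le> A" using assms by (simp add: A_def)
  have a: "0 \<le> a i / A" "a i / A * A = a i" if "i \<in> I" for i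
    using that assms(3) A by (auto simp: less_imp_le)
  have "(\<Sum>s\<in>S. \<Prod>i\<in>I. f i s epowr a i) = (\<Sum>s\<in>S. (\<Prod>i\<in>I. f i s epowr (a i / A)) epowr A)"
    using A a by (simp add: epowr_prod epowr_epowr)
  also have "\<dots> \<le> (\<Sum>s\<in>S. \<Prod>i\<in>I. f i s epowr (a i / A)) epowr A"
    using assms A by (intro sum_epowr_le) auto
  also have "\<dots> \<le> (\<Prod>i\<in>I. (\<Sum>s\<in>S. f i s) epowr (a i / A)) epowr A"
    using nn_integral_prod_epowr_le[of I "\<lambda>i. a i / A" f "count_space S"] assms A
    by (intro epowr_mono)
       (auto simp: nn_integral_count_space_finite A_def simp flip: sum_divide_distrib)
  also have "\<dots> = (\<Prod>i\<in>I. (\<Sum>s\<in>S. f i s) epowr a i)"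
    using A a by (simp add: epowr_prod epowr_epowr)
  finally show ?thesis .
qed

subsection \<open>Sparse selection\<close>

text \<open>Whether \<open>i\<close> is selected depends only on the selected indices below
  \<open>i\<close>, so a selection extends by one index without revising earlier decisions.\<close>

lemma greedy_selection:
  fixes B :: "nat \<Rightarrow> 'a set" and P :: "'a set \<Rightarrow> 'a set \<Rightarrow> bool"
  obtains S where "S \<subseteq> {..<N}"
    and "\<And>i. i \<in> S \<Longrightarrow> P (B i) (\<Union>j\<in>{j\<in>S. j < i}. B j)"
    and "\<And>i. i < N \<Longrightarrow> i \<notin> S \<Longrightarrow> \<not> P (B i) (\<Union>j\<in>{j\<in>S. j < i}. B j)"
proof -
  have "\<exists>S\<subseteq>{..<N}. \<forall>i<N. i \<in> S \<longleftrightarrow> P (B i) (\<Union>j\<in>{j\<in>S. j < i}. B j)"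
  proof (induction N)
    case (Suc n)
    then obtain S where S: "S \<subseteq> {..<n}" "\<forall>i<n. i \<in> S \<longleftrightarrow> P (B i) (\<Union>j\<in>{j\<in>S. j < i}. B j)"
      by blast
    define S' where "S' = (if P (B n) (\<Union>j\<in>S. B j) then insert n S else S)"
    have "{j\<in>S'. j < i} = {j\<in>S. j < i}" if "i \<le> n" for i
      using that by (auto simp: S'_def)
    moreover have "{j\<in>S. j < n} = S" using S by auto
    ultimately have "\<forall>i<Suc n. i \<in> S' \<longleftrightarrow> P (B i) (\<Union>j\<in>{j\<in>S'. j < i}. B j)"
      using S by (auto simp: S'_def less_Suc_eq)
    moreover have "S' \<subseteq> {..<Suc n}" using S by (auto simp: S'_def)
    ultimately show ?case by blast
  qed simp
  then obtain S where "S \<subseteq> {..<N}" "\<forall>i<N. i \<in> S \<longleftrightarrow> P (B i) (\<Union>j\<in>{j\<in>S. j < i}. B j)"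
    by blast
  then show thesis by (intro that[of S]) auto
qed

text \<open>Summation by parts, arranged so that no subtraction of possibly infinite values occurs.\<close>

lemma sum_antimono_mult_le:
  fixes c a b :: "nat \<Rightarrow> ennreal"
  assumes "\<And>i j. i \<le> j \<Longrightarrow> j < N \<Longrightarrow> c j \<le> c i"
    and "\<And>n. n \<le> N \<Longrightarrow> (\<Sum>i<n. a i) \<le> K * (\<Sum>i<n. b i)"
  shows "(\<Sum>i<N. c i * a i) \<le> K * (\<Sum>i<N. c i * b i)"
  using assms
proof (induction N arbitrary: c)
  case (Suc n)
  \<comment> \<open>The smallest coefficient \<open>c n\<close> is split off and multiplies the full
    sums; the differences \<open>d\<close> decrease again and go to the induction hypothesis. Since
    \<open>c n \<le> c i\<close>, the identity \<open>c i = c n + d i\<close> survives infinite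
    values.\<close>
  define d where "d i = c i - c n" for i
  have c: "c i = c n + d i" if "i < n" for i
    unfolding d_def using Suc.prems(1)[of i n] that by (simp add: add_diff_inverse_ennreal)
  have split: "(\<Sum>i<Suc n. c i * u i) = c n * (\<Sum>i<Suc n. u i) + (\<Sum>i<n. d i * u i)"
    for u :: "nat \<Rightarrow> ennreal"
  proof -
    have "(\<Sum>i<n. c i * u i) = (\<Sum>i<n. c n * u i + d i * u i)"
      using c by (intro sum.cong) (auto simp: distrib_right)
    then show ?thesis
      by (simp add: sum.distrib sum_distrib_left distrib_left ac_simps)
  qed
  have "(\<Sum>i<n. d i * a i) \<le> K * (\<Sum>i<n. d i * b i)"
    using Suc.prems by (intro Suc.IH) (auto simp: d_def intro!: ennreal_minus_mono)
  moreover have "c n * (\<Sum>i<Suc n. a i) \<le> c n * (K * (\<Sum>i<Suc n. b i))"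
    using Suc.prems(2)[of "Suc n"] by (intro mult_left_mono) auto
  ultimately have "c n * (\<Sum>i<Suc n. a i) + (\<Sum>i<n. d i * a i)
      \<le> K * (c n * (\<Sum>i<Suc n. b i) + (\<Sum>i<n. d i * b i))"
    unfolding distrib_left by (metis add_mono mult.left_commute)
  then show ?case
    unfolding split .
qed simp

lemma finite_antimono_enumeration:
  fixes k :: "'a \<Rightarrow> 'b::linorder"
  assumes "finite F"
  obtains B :: "nat \<Rightarrow> 'a" where "bij_betw B {..<card F} F"
    and "\<And>i j. i \<le> j \<Longrightarrow> j < card F \<Longrightarrow> k (B j) \<le> k (B i)"
proof -
  obtain xs where xs: "set xs = F" "distinct xs"
    using finite_distinct_list[OF assms] by blast
  define ys where "ys = rev (sort_key k xs)"
  have ys: "set ys = F" "distinct ys" "length ys = card F"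
    using xs by (auto simp: ys_def distinct_card)
  have "sorted (rev (map k ys))"
    by (simp add: ys_def rev_map)
  then have "k (ys ! j) \<le> k (ys ! i)" if "i \<le> j" "j < card F" for i j
    using that ys(3) sorted_rev_iff_nth_mono[of "map k ys"] by auto
  moreover have "bij_betw ((!) ys) {..<card F} F"
    using ys bij_betw_nth[of ys] by auto
  ultimately show thesis by (rule that[rotated])
qed

section \<open>Weighted measures, averages and the sets of a basis\<close>

lemma wmeas_mono: "A \<subseteq> B \<Longrightarrow> wmeas w A \<le> wmeas w B"
  unfolding wmeas_def by (intro nn_integral_mono) (auto split: split_indicator)

lemma wmeas_eq_emeasure:
  assumes "w \<in> borel_measurable lebesgue" "A \<in> sets lebesgue"
  shows "wmeas w A = emeasure (density lebesgue (\<lambda>x. ennreal (w x))) A"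
  using assms by (simp add: wmeas_def emeasure_density)

lemma avg_indicator:
  assumes "A \<in> sets lebesgue" "B \<in> sets lebesgue"
  shows "avg B (\<lambda>y. ennreal \<bar>indicator A y\<bar>) = emeasure lebesgue (A \<inter> B) / emeasure lebesgue B"
proof -
  have "(\<integral>\<^sup>+y\<in>B. ennreal \<bar>indicator A y\<bar> \<partial>lebesgue) = (\<integral>\<^sup>+y. indicator (A \<inter> B) y \<partial>lebesgue)"
    by (intro nn_integral_cong) (auto split: split_indicator)
  then show ?thesis using assms by (simp add: avg_def)
qed

lemma avg_le_maximal:
  "B \<in> \<B> \<Longrightarrow> x \<in> B \<Longrightarrow> avg B (\<lambda>y. ennreal \<bar>f y\<bar>) \<le> maximal \<B> f x"
  unfolding maximal_def by (rule SUP_upper) auto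

lemma is_basisD:
  assumes "is_basis \<B>" "B \<in> \<B>"
  shows "open B" "emeasure lebesgue B < top" "B \<in> sets lebesgue"
    "B \<noteq> {} \<Longrightarrow> 0 < emeasure lebesgue B"
proof -
  show 1: "open B" "emeasure lebesgue B < top"
    using assms by (auto simp: is_basis_def)
  then show "B \<in> sets lebesgue" by auto
  show "0 < emeasure lebesgue B" if "B \<noteq> {}"
    using open_not_negligible[OF 1(1) that] negligible_iff_emeasure0[of B] 1(1)
    by (auto simp: zero_less_iff_neq_zero)
qed

text \<open>The average over \<open>B\<close> itself already exceeds \<open>\<gamma>\<close>;
  strictness survives the division because the measure of \<open>B\<close> is positive and
  finite.\<close>

lemma maximal_indicator_gt:
  assumes basis: "is_basis \<B>" and "B \<in> \<B>" "x \<in> B" "A \<in> sets lebesgue"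
    and large: "ennreal \<gamma> * emeasure lebesgue B < emeasure lebesgue (A \<inter> B)"
  shows "ennreal \<gamma> < maximal \<B> (indicator A) x"
proof -
  note B = is_basisD[OF basis \<open>B \<in> \<B>\<close>]
  have pos: "0 < emeasure lebesgue B" using B assms by blast
  have "\<not> emeasure lebesgue (A \<inter> B) / emeasure lebesgue B \<le> ennreal \<gamma>"
  proof
    assume "emeasure lebesgue (A \<inter> B) / emeasure lebesgue B \<le> ennreal \<gamma>"
    then have "emeasure lebesgue (A \<inter> B) / emeasure lebesgue B * emeasure lebesgue B
        \<le> ennreal \<gamma> * emeasure lebesgue B"
      by (rule mult_right_mono) simp
    then show False
      using large B pos by (simp add: ennreal_divide_times)
  qed
  then have "ennreal \<gamma> < emeasure lebesgue (A \<inter> B) / emeasure lebesgue B" by simp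
  also have "\<dots> = avg B (\<lambda>y. ennreal \<bar>indicator A y\<bar>)"
    using assms B by (intro avg_indicator[symmetric])
  also have "\<dots> \<le> maximal \<B> (indicator A) x"
    using assms by (intro avg_le_maximal)
  finally show ?thesis .
qed

text \<open>The covering step for a finite family, where \<open>k B\<close> will be the q-th power
  of the quantity attached to \<open>B\<close>. A set is kept when at most the fraction
  \<open>\<gamma>\<close> of it is covered by the kept sets preceding it in the order of decreasing
  \<open>k\<close>.\<close>

lemma finite_sparse_domination:
  fixes \<B> :: "(real ^ 'n) set set" and k :: "(real ^ 'n) set \<Rightarrow> ennreal"
  assumes basis: "is_basis \<B>" and v[measurable]: "v \<in> borel_measurable lebesgue"
    and \<gamma>: "0 < \<gamma>" "\<gamma> < 1"
    and tau: "\<And>E. E \<in> sets lebesgue \<Longrightarrow>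
      wmeas v {x. maximal \<B> (indicator E) x > ennreal \<gamma>} \<le> K * wmeas v E"
    and F: "finite F" "F \<subseteq> \<B>"
  obtains S E where "S \<subseteq> F" "disjoint_family_on E S"
    "\<And>B. B \<in> S \<Longrightarrow> E B \<in> sets lebesgue \<and> E B \<subseteq> B
       \<and> ennreal (1 - \<gamma>) * emeasure lebesgue B \<le> emeasure lebesgue (E B)"
    "(\<integral>\<^sup>+x. (SUP B\<in>{B\<in>F. x \<in> B}. k B) * ennreal (v x) \<partial>lebesgue)
       \<le> K * (\<Sum>B\<in>S. k B * wmeas v B)"
proof -
  define \<mu> where "\<mu> = density lebesgue (\<lambda>x. ennreal (v x))"
  have sets_\<mu>: "sets \<mu> = sets lebesgue" by (simp add: \<mu>_def)
  have \<mu>: "wmeas v A = emeasure \<mu> A" if "A \<in> sets lebesgue" for A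
    using that by (simp add: wmeas_eq_emeasure \<mu>_def)
  obtain B where bij: "bij_betw B {..<card F} F"
    and anti: "\<And>i j. i \<le> j \<Longrightarrow> j < card F \<Longrightarrow> k (B j) \<le> k (B i)"
    using finite_antimono_enumeration[OF F(1), of k] by blast
  define N where "N = card F"
  have BF: "B i \<in> F" "B i \<in> \<B>" if "i < N" for i
    using bij that F by (auto simp: N_def bij_betw_def)
  note B = is_basisD[OF basis BF(2)]
  have inj: "inj_on B {..<N}" using bij by (auto simp: N_def bij_betw_def)
  obtain S where S: "S \<subseteq> {..<N}"
    and sel: "\<And>i. i \<in> S \<Longrightarrow> emeasure lebesgue ((\<Union>j\<in>{j\<in>S. j < i}. B j) \<inter> B i) \<le> ennreal \<gamma> * emeasure lebesgue (B i)"
    and nsel: "\<And>i. i < N \<Longrightarrow> i \<notin> S \<Longrightarrow> \<not> emeasure lebesgue ((\<Union>j\<in>{j\<in>S. j < i}. B j) \<inter> B i) \<le> ennreal \<gamma> * emeasure lebesgue (B i)"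
    using greedy_selection[of N "\<lambda>B U. emeasure lebesgue (U \<inter> B) \<le> ennreal \<gamma> * emeasure lebesgue B" B]
    by blast
  have finS: "finite S" using S finite_subset by blast
  \<comment> \<open>Removing the selected predecessors makes these parts disjoint, and by the
    selection criterion it costs at most the fraction \<open>\<gamma>\<close> of
    \<open>B i\<close>.\<close>
  define E where "E i = B i - (\<Union>j\<in>{j\<in>S. j < i}. B j)" for i
  have Esets: "E i \<in> sets lebesgue" if "i \<in> S" for i
    using that S finS B(3) unfolding E_def by (intro sets.Diff sets.finite_UN) auto
  have Elarge: "ennreal (1 - \<gamma>) * emeasure lebesgue (B i) \<le> emeasure lebesgue (E i)" if i: "i \<in> S" for i
  proof -
    have iN: "i < N" using i S by auto
    have U: "(\<Union>j\<in>{j\<in>S. j < i}. B j) \<in> sets lebesgue"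
      using S finS B(3) by (intro sets.finite_UN) auto
    have fin: "ennreal \<gamma> * emeasure lebesgue (B i) \<noteq> top"
      using B(2)[OF iN] by (simp add: ennreal_mult_eq_top_iff)
    \<comment> \<open>The estimate is kept additive, so that the finite term with
      \<open>\<gamma>\<close> can be cancelled at the end.\<close>
    have "ennreal (1 - \<gamma>) * emeasure lebesgue (B i) + ennreal \<gamma> * emeasure lebesgue (B i)
      = emeasure lebesgue (B i)"
      using \<gamma> by (simp flip: distrib_right ennreal_plus)
    also have "\<dots> = emeasure lebesgue (E i) + emeasure lebesgue ((\<Union>j\<in>{j\<in>S. j < i}. B j) \<inter> B i)"
    proof -
      have eq: "E i \<union> ((\<Union>j\<in>{j\<in>S. j < i}. B j) \<inter> B i) = B i"
        and disj: "E i \<inter> ((\<Union>j\<in>{j\<in>S. j < i}. B j) \<inter> B i) = {}" by (auto simp: E_def)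
      show ?thesis
        using plus_emeasure[OF Esets[OF i] sets.Int[OF U B(3)[OF iN]] disj] by (simp only: eq)
    qed
    also have "\<dots> \<le> emeasure lebesgue (E i) + ennreal \<gamma> * emeasure lebesgue (B i)"
      using sel[OF i] by (rule add_left_mono)
    finally show ?thesis
      using fin by (simp add: add.commute ennreal_add_left_cancel_le)
  qed
  \<comment> \<open>Each of the first \<open>n\<close> sets has more than the fraction
    \<open>\<gamma>\<close> inside the union \<open>U\<close> of the selected ones: a selected set
    lies in \<open>U\<close>, a discarded one violates the criterion. So all of them lie where the
    maximal function of \<open>U\<close> exceeds \<open>\<gamma>\<close>.\<close>
  have union_le: "wmeas v (\<Union>i<n. B i) \<le> K * (\<Sum>i\<in>S \<inter> {..<n}. wmeas v (B i))" if n: "n \<le> N" for n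
  proof -
    define U where "U = (\<Union>j\<in>S \<inter> {..<n}. B j)"
    have U: "U \<in> sets lebesgue"
      unfolding U_def using S finS B(3) by (intro sets.finite_UN) auto
    have "x \<in> {x. maximal \<B> (indicator U) x > ennreal \<gamma>}" if x: "x \<in> B i" "i < n" for x i
    proof -
      have iN: "i < N" using x n by simp
      note Bi = B(1,2,3,4)[OF iN]
      have "ennreal \<gamma> * emeasure lebesgue (B i) < emeasure lebesgue (U \<inter> B i)"
      proof (cases "i \<in> S")
        case True
        then have "U \<inter> B i = B i" using x by (auto simp: U_def)
        moreover have "ennreal \<gamma> * emeasure lebesgue (B i) < 1 * emeasure lebesgue (B i)"
          using Bi x \<gamma> by (intro ennreal_mult_strict_right_mono) (auto simp: ennreal_less_one_iff)
        ultimately show ?thesis by simp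
      next
        case False
        have "ennreal \<gamma> * emeasure lebesgue (B i) < emeasure lebesgue ((\<Union>j\<in>{j\<in>S. j < i}. B j) \<inter> B i)"
          using nsel[OF iN False] by simp
        also have "\<dots> \<le> emeasure lebesgue (U \<inter> B i)"
          using x U Bi by (intro emeasure_mono sets.Int) (auto simp: U_def)
        finally show ?thesis .
      qed
      then show ?thesis
        using maximal_indicator_gt[OF basis BF(2)[OF iN] x(1) U] by simp
    qed
    then have "wmeas v (\<Union>i<n. B i) \<le> wmeas v {x. maximal \<B> (indicator U) x > ennreal \<gamma>}"
      by (intro wmeas_mono) blast
    also have "\<dots> \<le> K * wmeas v U" by (rule tau[OF U])
    also have "wmeas v U \<le> (\<Sum>i\<in>S \<inter> {..<n}. wmeas v (B i))"
    proof -
      have m: "B i \<in> sets lebesgue" if "i \<in> S" for i using that S B(3) by auto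
      have "emeasure \<mu> U \<le> (\<Sum>i\<in>S \<inter> {..<n}. emeasure \<mu> (B i))"
        unfolding U_def using m finS by (intro emeasure_subadditive_finite) (auto simp: sets_\<mu>)
      also have "\<dots> = (\<Sum>i\<in>S \<inter> {..<n}. wmeas v (B i))"
        using m by (intro sum.cong) (auto simp: \<mu>)
      finally show ?thesis using U by (simp add: \<mu>)
    qed
    finally show ?thesis by (simp add: mult_left_mono)
  qed
  \<comment> \<open>Now all predecessors are removed, selected or not. On \<open>D i\<close> the set
    \<open>B i\<close> is the first one containing the point and therefore attains the supremum of
    \<open>k\<close> there.\<close>
  define D where "D i = B i - (\<Union>j<i. B j)" for i
  have D: "D i \<in> sets lebesgue" if "i < N" for i
    using that B(3) unfolding D_def by (intro sets.Diff sets.finite_UN) auto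
  have disjD: "disjoint_family_on D A" for A
    using disjoint_family_disjointed[of B] disjoint_family_on_mono[of A UNIV]
    unfolding D_def disjointed_def lessThan_atLeast0 by blast
  have sup_le: "(SUP B\<in>{B\<in>F. x \<in> B}. k B) \<le> (\<Sum>i<N. k (B i) * indicator (D i) x)" for x
  proof (rule SUP_least)
    fix A assume "A \<in> {B\<in>F. x \<in> B}"
    then obtain a where a: "a < N" "A = B a" "x \<in> B a"
      using bij by (auto simp: N_def bij_betw_def)
    obtain i where i: "x \<in> B i" "i \<le> a" "\<And>j. j < i \<Longrightarrow> x \<notin> B j"
      using LeastI[of "\<lambda>i. x \<in> B i", OF a(3)] Least_le[of "\<lambda>i. x \<in> B i", OF a(3)]
        not_less_Least[of _ "\<lambda>i. x \<in> B i"] by blast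
    have "k A \<le> k (B i) * indicator (D i) x"
      using anti[of i a] i a by (simp add: N_def D_def)
    also have "\<dots> \<le> (\<Sum>i<N. k (B i) * indicator (D i) x)"
      using i a by (intro member_le_sum) auto
    finally show "k A \<le> (\<Sum>i<N. k (B i) * indicator (D i) x)" .
  qed
  have "(\<integral>\<^sup>+x. (SUP B\<in>{B\<in>F. x \<in> B}. k B) * ennreal (v x) \<partial>lebesgue)
      \<le> (\<integral>\<^sup>+x. (\<Sum>i<N. k (B i) * (ennreal (v x) * indicator (D i) x)) \<partial>lebesgue)"
  proof (rule nn_integral_mono)
    fix x
    have "(SUP B\<in>{B\<in>F. x \<in> B}. k B) * ennreal (v x)
        \<le> (\<Sum>i<N. k (B i) * indicator (D i) x) * ennreal (v x)"
      by (rule mult_right_mono[OF sup_le]) simp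
    also have "\<dots> = (\<Sum>i<N. k (B i) * (ennreal (v x) * indicator (D i) x))"
      unfolding sum_distrib_right by (simp only: ac_simps)
    finally show "(SUP B\<in>{B\<in>F. x \<in> B}. k B) * ennreal (v x)
        \<le> (\<Sum>i<N. k (B i) * (ennreal (v x) * indicator (D i) x))" .
  qed
  also have "\<dots> = (\<Sum>i<N. k (B i) * wmeas v (D i))"
  proof -
    have "(\<lambda>x. ennreal (v x) * indicator (D i) x) \<in> borel_measurable lebesgue" if "i < N" for i
      using D[OF that] by measurable
    then show ?thesis
      by (subst nn_integral_sum) (auto simp: nn_integral_cmult wmeas_def)
  qed
  \<comment> \<open>Summation by parts: the sets \<open>D i\<close> with \<open>i < n\<close> are
    disjoint and fill the union of the first \<open>n\<close> sets, so \<open>union_le\<close>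
    bounds the partial sums; discarded indices count as 0 on the right.\<close>
  also have "\<dots> \<le> K * (\<Sum>i<N. k (B i) * (if i \<in> S then wmeas v (B i) else 0))"
  proof (rule sum_antimono_mult_le)
    fix n assume n: "n \<le> N"
    have "(\<Sum>i<n. wmeas v (D i)) = (\<Sum>i<n. emeasure \<mu> (D i))"
      using n D by (intro sum.cong) (auto simp: \<mu>)
    also have "\<dots> = emeasure \<mu> (\<Union>i<n. D i)"
      using n D disjD by (intro sum_emeasure) (auto simp: sets_\<mu>)
    also have "(\<Union>i<n. D i) = (\<Union>i<n. B i)"
      using finite_UN_disjointed_eq[where A = B and n = n] unfolding D_def disjointed_def lessThan_atLeast0 .
    also have "emeasure \<mu> \<dots> = wmeas v \<dots>"
      using n B(3) by (intro \<mu>[symmetric] sets.finite_UN) auto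
    also have "\<dots> \<le> K * (\<Sum>i\<in>S \<inter> {..<n}. wmeas v (B i))" by (rule union_le[OF n])
    also have "(\<Sum>i\<in>S \<inter> {..<n}. wmeas v (B i)) = (\<Sum>i<n. if i \<in> S then wmeas v (B i) else 0)"
      by (subst Int_commute, subst sum.inter_restrict) auto
    finally show "(\<Sum>i<n. wmeas v (D i)) \<le> K * (\<Sum>i<n. if i \<in> S then wmeas v (B i) else 0)" .
  qed (use anti N_def in auto)
  also have "(\<Sum>i<N. k (B i) * (if i \<in> S then wmeas v (B i) else 0)) = (\<Sum>i\<in>S. k (B i) * wmeas v (B i))"
    using S by (subst sum.mono_neutral_cong_right[of "{..<N}" S _ "\<lambda>i. k (B i) * wmeas v (B i)"]) auto
  also have "\<dots> = (\<Sum>A\<in>B ` S. k A * wmeas v A)"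
    using inj S by (simp add: sum.reindex inj_on_subset)
  finally have main: "(\<integral>\<^sup>+x. (SUP B\<in>{B\<in>F. x \<in> B}. k B) * ennreal (v x) \<partial>lebesgue)
      \<le> K * (\<Sum>A\<in>B ` S. k A * wmeas v A)" .
  \<comment> \<open>The parts are indexed by sets instead of positions, which is unambiguous because
    \<open>B\<close> is injective.\<close>
  define E' where "E' A = E (the_inv_into {..<N} B A)" for A
  have E': "E' (B i) = E i" if "i \<in> S" for i
    using that S inj by (auto simp: E'_def the_inv_into_f_f)
  have disjE: "E i \<inter> E j = {}" if "i \<in> S" "j \<in> S" "i \<noteq> j" for i j
    using that by (cases i j rule: linorder_cases) (auto simp: E_def)
  show thesis
  proof (rule that[of "B ` S" E'])
    show "B ` S \<subseteq> F" using S BF by auto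
    show "disjoint_family_on E' (B ` S)"
      unfolding disjoint_family_on_def
    proof (intro ballI impI)
      fix A A' assume "A \<in> B ` S" "A' \<in> B ` S" "A \<noteq> A'"
      then obtain i j where "i \<in> S" "j \<in> S" "A = B i" "A' = B j" "i \<noteq> j" by blast
      then show "E' A \<inter> E' A' = {}" using disjE E' by simp
    qed
    show "E' A \<in> sets lebesgue \<and> E' A \<subseteq> A
       \<and> ennreal (1 - \<gamma>) * emeasure lebesgue A \<le> emeasure lebesgue (E' A)" if "A \<in> B ` S" for A
      using that E' Esets Elarge by (auto simp: E_def)
  qed (rule main)
qed

subsection \<open>Suprema over open sets and the unweighted maximal theorem\<close>

text \<open>On the right the index set no longer depends on \<open>x\<close>, so measurability in
  \<open>x\<close> can be read off for a countable family of measurable sets.\<close>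

lemma SUP_members_eq_SUP_indicator:
  fixes k :: "'a set \<Rightarrow> ennreal"
  shows "(SUP B\<in>{B\<in>F. x \<in> B}. k B) = (SUP B\<in>F. k B * indicator B x)"
proof (rule antisym)
  show "(SUP B\<in>{B\<in>F. x \<in> B}. k B) \<le> (SUP B\<in>F. k B * indicator B x)"
    by (rule SUP_mono, rule bexI) auto
  show "(SUP B\<in>F. k B * indicator B x) \<le> (SUP B\<in>{B\<in>F. x \<in> B}. k B)"
  proof (rule SUP_least)
    fix B assume "B \<in> F"
    then show "k B * indicator B x \<le> (SUP B\<in>{B\<in>F. x \<in> B}. k B)"
      by (cases "x \<in> B") (auto intro: SUP_upper)
  qed
qed

text \<open>For every rational level \<open>t\<close>, Lindeloef's theorem gives countably many sets
  with \<open>k B > t\<close> that cover the union of all such sets. The supremum at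
  \<open>x\<close> is determined by the rational levels whose union contains
  \<open>x\<close>.\<close>

lemma countable_subfamily_SUP:
  fixes \<B> :: "'a::second_countable_topology set set" and k :: "'a set \<Rightarrow> ennreal"
  assumes "\<And>B. B \<in> \<B> \<Longrightarrow> open B"
  obtains \<G> where "countable \<G>" "\<G> \<subseteq> \<B>"
    "\<And>x. (SUP B\<in>{B\<in>\<B>. x \<in> B}. k B) = (SUP B\<in>{B\<in>\<G>. x \<in> B}. k B)"
proof -
  have "\<exists>\<G>. \<G> \<subseteq> {B\<in>\<B>. k B > t} \<and> countable \<G> \<and> \<Union>\<G> = \<Union>{B\<in>\<B>. k B > t}" for t
    using Lindelof[of "{B\<in>\<B>. k B > t}"] assms by (metis (mono_tags, lifting) mem_Collect_eq)
  then obtain L where L: "\<And>t. L t \<subseteq> {B\<in>\<B>. k B > t}" "\<And>t. countable (L t)"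
      "\<And>t. \<Union>(L t) = \<Union>{B\<in>\<B>. k B > t}"
    by metis
  define \<G> where "\<G> = (\<Union>t::rat. L (ennreal (real_of_rat t)))"
  show thesis
  proof (rule that[of \<G>])
    show "countable \<G>" unfolding \<G>_def using L(2) by blast
    show sub: "\<G> \<subseteq> \<B>" unfolding \<G>_def using L(1) by blast
    fix x
    show "(SUP B\<in>{B\<in>\<B>. x \<in> B}. k B) = (SUP B\<in>{B\<in>\<G>. x \<in> B}. k B)"
    proof (rule antisym)
      show "(SUP B\<in>{B\<in>\<B>. x \<in> B}. k B) \<le> (SUP B\<in>{B\<in>\<G>. x \<in> B}. k B)"
      proof (rule SUP_least, rule dense_le)
        fix B y assume B: "B \<in> {B\<in>\<B>. x \<in> B}" and "y < k B"
        then obtain t where t: "y < ennreal (real_of_rat t)" "ennreal (real_of_rat t) < k B"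
          using ennreal_rat_dense by blast
        then have "x \<in> \<Union>(L (ennreal (real_of_rat t)))" using B L(3) by blast
        then obtain B' where B': "B' \<in> L (ennreal (real_of_rat t))" "x \<in> B'" by blast
        then have "ennreal (real_of_rat t) < k B'" using L(1) by blast
        then have "y \<le> k B'" using t(1) by order
        also have "\<dots> \<le> (SUP B\<in>{B\<in>\<G>. x \<in> B}. k B)"
          using B' by (intro SUP_upper) (auto simp: \<G>_def)
        finally show "y \<le> (SUP B\<in>{B\<in>\<G>. x \<in> B}. k B)" .
      qed
      show "(SUP B\<in>{B\<in>\<G>. x \<in> B}. k B) \<le> (SUP B\<in>{B\<in>\<B>. x \<in> B}. k B)"
        using sub by (intro SUP_subset_mono) auto
    qed
  qed
qed

text \<open>The supremum equals one over a countable subfamily, hence is the increasing limit of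
  suprema over finite families, to which monotone convergence applies.\<close>

lemma nn_integral_SUP_open_le:
  fixes \<B> :: "'a::euclidean_space set set" and k :: "'a set \<Rightarrow> ennreal"
  assumes op: "\<And>B. B \<in> \<B> \<Longrightarrow> open B"
    and v[measurable]: "v \<in> borel_measurable lebesgue"
    and fin: "\<And>F. finite F \<Longrightarrow> F \<subseteq> \<B> \<Longrightarrow>
      (\<integral>\<^sup>+x. (SUP B\<in>{B\<in>F. x \<in> B}. k B) * v x \<partial>lebesgue) \<le> R"
  shows "(\<integral>\<^sup>+x. (SUP B\<in>{B\<in>\<B>. x \<in> B}. k B) * v x \<partial>lebesgue) \<le> R"
proof -
  obtain \<G> where \<G>: "countable \<G>" "\<G> \<subseteq> \<B>"
    and eq: "\<And>x. (SUP B\<in>{B\<in>\<B>. x \<in> B}. k B) = (SUP B\<in>{B\<in>\<G>. x \<in> B}. k B)"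
    using countable_subfamily_SUP[OF op, of \<B> k] by blast
  show ?thesis
  proof (cases "\<G> = {}")
    case True
    then show ?thesis using fin[of "{}"] by (simp add: eq)
  next
    case False
    define F where "F n = from_nat_into \<G> ` {..n}" for n
    have F: "finite (F n)" "F n \<subseteq> \<G>" for n
      using from_nat_into[OF False] by (auto simp: F_def)
    have Un: "(\<Union>n. F n) = \<G>"
    proof -
      have "(\<Union>n. F n) = from_nat_into \<G> ` (\<Union>n. {..n})" by (simp only: F_def image_UN)
      also have "(\<Union>n. {..n}) = (UNIV :: nat set)" by auto
      finally show ?thesis using range_from_nat_into[OF False \<G>(1)] by simp
    qed
    define g where "g n x = (SUP B\<in>{B\<in>F n. x \<in> B}. k B)" for n x
    have "(SUP B\<in>{B\<in>\<G>. x \<in> B}. k B) = (SUP n. g n x)" for x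
    proof -
      have "{B\<in>\<G>. x \<in> B} = (\<Union>n. {B\<in>F n. x \<in> B})" using Un by blast
      then show ?thesis by (simp only: g_def SUP_UNION)
    qed
    then have "(\<integral>\<^sup>+x. (SUP B\<in>{B\<in>\<B>. x \<in> B}. k B) * v x \<partial>lebesgue)
      = (\<integral>\<^sup>+x. (SUP n. g n x * v x) \<partial>lebesgue)"
      by (simp add: eq SUP_mult_right_ennreal)
    also have "\<dots> = (SUP n. \<integral>\<^sup>+x. g n x * v x \<partial>lebesgue)"
    proof (rule nn_integral_monotone_convergence_SUP)
      show "incseq (\<lambda>n x. g n x * v x)"
      proof (intro incseq_SucI le_funI mult_right_mono)
        show "g n x \<le> g (Suc n) x" for n x
          unfolding g_def by (rule SUP_subset_mono) (auto simp: F_def)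
      qed simp
      fix n
      have eq: "g n = (\<lambda>x. SUP B\<in>F n. k B * indicator B x)"
        unfolding g_def SUP_members_eq_SUP_indicator by (rule refl)
      have "(\<lambda>x. SUP B\<in>F n. k B * indicator B x) \<in> borel_measurable lebesgue"
      proof (rule borel_measurable_SUP)
        fix B assume "B \<in> F n"
        then have "open B" using F(2) \<G>(2) op by blast
        then have [measurable]: "B \<in> sets lebesgue" by simp
        show "(\<lambda>x. k B * indicator B x) \<in> borel_measurable lebesgue" by measurable
      qed (simp add: F countable_finite)
      then have [measurable]: "g n \<in> borel_measurable lebesgue"
        by (simp only: eq)
      show "(\<lambda>x. g n x * v x) \<in> borel_measurable lebesgue" by measurable
    qed
    also have "\<dots> \<le> R"
    proof (rule SUP_least)
      fix n
      show "(\<integral>\<^sup>+x. g n x * v x \<partial>lebesgue) \<le> R"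
        unfolding g_def by (rule fin[OF F(1) order_trans[OF F(2) \<G>(2)]])
    qed
    finally show ?thesis .
  qed
qed

section \<open>The maximal theorem for the constant weight and its use on sparse families\<close>

lemma avg_one_le: "B \<in> sets lebesgue \<Longrightarrow> avg B (\<lambda>_. 1) \<le> 1"
  by (cases "emeasure lebesgue B = 0 \<or> emeasure lebesgue B = top")
     (auto simp: avg_def less_top)

text \<open>Every power of 1 is 1 and its averages are at most 1 (0 on the empty set), so the
  constant of the class is at most 1. Finite measure of the basis sets makes 1 a weight.\<close>

lemma A_class_one:
  assumes "is_basis \<B>" "1 < s"
  shows "A_class \<B> s (\<lambda>_. 1)"
proof -
  note basis = is_basisD[OF assms(1)]
  have "avg B (\<lambda>_. 1) * (avg B (\<lambda>_. 1) epowr (s / conj_exp s)) \<le> 1 * (1 epowr (s / conj_exp s))"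
    if "B \<in> \<B>" for B
    using basis(3)[OF that] assms(2)
    by (intro mult_mono epowr_mono avg_one_le) (auto simp: conj_exp_def)
  then have "(SUP B\<in>\<B>. avg B (\<lambda>_. 1) * (avg B (\<lambda>_. 1) epowr (s / conj_exp s))) \<le> 1"
    by (intro SUP_least) simp
  also have "1 < (\<infinity> :: ennreal)" by simp
  finally have "(SUP B\<in>\<B>. avg B (\<lambda>_. 1) * (avg B (\<lambda>_. 1) epowr (s / conj_exp s))) < \<infinity>" .
  moreover have "weight \<B> (\<lambda>_. 1)"
    unfolding weight_def wmeas_def
  proof (intro conjI ballI)
    fix B assume "B \<in> \<B>"
    from basis(2,3)[OF this] show "(\<integral>\<^sup>+x\<in>B. ennreal 1 \<partial>lebesgue) < \<infinity>" by simp
  qed auto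
  ultimately show ?thesis
    by (simp add: A_class_def)
qed

text \<open>The defining property for the weight 1, with both norms raised to the power
  \<open>s\<close> to remove the roots.\<close>

lemma muckenhoupt_basis_unweighted:
  fixes \<B> :: "(real ^ 'n) set set"
  assumes "muckenhoupt_basis \<B>" "1 < s"
  obtains C where "C < top"
    "\<And>f. f \<in> borel_measurable lebesgue \<Longrightarrow>
       (\<integral>\<^sup>+x. maximal \<B> f x epowr s \<partial>lebesgue) \<le> C * (\<integral>\<^sup>+x. ennreal \<bar>f x\<bar> epowr s \<partial>lebesgue)"
proof -
  obtain C where C: "\<And>f. f \<in> borel_measurable lebesgue \<Longrightarrow>
      wnorm s (\<lambda>_. 1) (maximal \<B> f) \<le> ennreal C * wnorm s (\<lambda>_. 1) (\<lambda>x. ennreal \<bar>f x\<bar>)"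
    using assms A_class_one[of \<B> s] unfolding muckenhoupt_basis_def by metis
  show thesis
  proof (rule that[of "ennreal C epowr s"])
    show "ennreal C epowr s < top"
      using assms(2) by (simp add: less_top[symmetric])
    fix f :: "real ^ 'n \<Rightarrow> real" assume "f \<in> borel_measurable lebesgue"
    from epowr_mono[OF C[OF this], of s] assms(2)
    show "(\<integral>\<^sup>+x. maximal \<B> f x epowr s \<partial>lebesgue)
        \<le> ennreal C epowr s * (\<integral>\<^sup>+x. ennreal \<bar>f x\<bar> epowr s \<partial>lebesgue)"
      by (simp add: wnorm_def epowr_mult epowr_epowr)
  qed
qed

text \<open>On \<open>E B\<close>, a subset of \<open>B\<close>, the maximal function is at least
  the average over \<open>B\<close>, and \<open>E B\<close> has at least the fraction
  \<open>\<eta>\<close> of the measure. By disjointness at most one term is nonzero at each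
  point.\<close>

lemma sparse_sum_le_maximal:
  fixes \<B> :: "(real ^ 'n) set set"
  assumes S: "finite S" "S \<subseteq> \<B>" and "0 < s" and disj: "disjoint_family_on E S"
    and E: "\<And>B. B \<in> S \<Longrightarrow> E B \<in> sets lebesgue \<and> E B \<subseteq> B \<and>
       ennreal \<eta> * emeasure lebesgue B \<le> emeasure lebesgue (E B)"
  shows "ennreal \<eta> * (\<Sum>B\<in>S. emeasure lebesgue B * avg B (\<lambda>x. ennreal \<bar>f x\<bar>) epowr s)
     \<le> (\<integral>\<^sup>+x. maximal \<B> f x epowr s \<partial>lebesgue)"
proof -
  define h where "h B = avg B (\<lambda>x. ennreal \<bar>f x\<bar>) epowr s" for B
  have "ennreal \<eta> * (\<Sum>B\<in>S. emeasure lebesgue B * h B)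
      \<le> (\<Sum>B\<in>S. h B * emeasure lebesgue (E B))"
    unfolding sum_distrib_left
  proof (rule sum_mono)
    fix B assume "B \<in> S"
    then have "ennreal \<eta> * emeasure lebesgue B \<le> emeasure lebesgue (E B)"
      using E by blast
    then have "ennreal \<eta> * emeasure lebesgue B * h B \<le> emeasure lebesgue (E B) * h B"
      by (rule mult_right_mono) simp
    then show "ennreal \<eta> * (emeasure lebesgue B * h B) \<le> h B * emeasure lebesgue (E B)"
      by (simp only: ac_simps)
  qed
  also have "\<dots> = (\<integral>\<^sup>+x. (\<Sum>B\<in>S. h B * indicator (E B) x) \<partial>lebesgue)"
  proof -
    have Es: "E B \<in> sets lebesgue" if "B \<in> S" for B using E[OF that] by blast
    have "(\<integral>\<^sup>+x. (\<Sum>B\<in>S. h B * indicator (E B) x) \<partial>lebesgue)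
        = (\<Sum>B\<in>S. \<integral>\<^sup>+x. h B * indicator (E B) x \<partial>lebesgue)"
    proof (rule nn_integral_sum)
      fix B assume "B \<in> S"
      from Es[OF this] show "(\<lambda>x. h B * indicator (E B) x) \<in> borel_measurable lebesgue" by measurable
    qed
    also have "\<dots> = (\<Sum>B\<in>S. h B * emeasure lebesgue (E B))"
      by (intro sum.cong refl nn_integral_cmult_indicator Es)
    finally show ?thesis by simp
  qed
  also have "\<dots> \<le> (\<integral>\<^sup>+x. maximal \<B> f x epowr s \<partial>lebesgue)"
  proof (rule nn_integral_mono)
    fix x
    show "(\<Sum>B\<in>S. h B * indicator (E B) x) \<le> maximal \<B> f x epowr s"
    proof (cases "\<exists>B\<in>S. x \<in> E B")
      case True
      then obtain A where A: "A \<in> S" "x \<in> E A" by blast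
      have "x \<notin> E B" if "B \<in> S" "B \<noteq> A" for B
        using disj A that unfolding disjoint_family_on_def by blast
      then have "(\<Sum>B\<in>S. h B * indicator (E B) x) = (\<Sum>B\<in>{A}. h B * indicator (E B) x)"
        using A S by (intro sum.mono_neutral_right) auto
      also have "\<dots> = h A" using A by simp
      also have "\<dots> \<le> maximal \<B> f x epowr s"
        unfolding h_def using A E S \<open>0 < s\<close> by (intro epowr_mono avg_le_maximal) auto
      finally show ?thesis .
    next
      case False
      then have "(\<Sum>B\<in>S. h B * indicator (E B) x) = 0" by (intro sum.neutral) auto
      then show ?thesis by simp
    qed
  qed
  finally show ?thesis by (simp add: h_def)
qed

subsection \<open>The bump condition\<close>

lemma nn_integral_mult_epowr_le:
  assumes "0 < a" "0 < b" "a + b = 1"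
    and "f \<in> borel_measurable M" "g \<in> borel_measurable M"
  shows "(\<integral>\<^sup>+x. f x epowr a * g x epowr b \<partial>M)
    \<le> (\<integral>\<^sup>+x. f x \<partial>M) epowr a * (\<integral>\<^sup>+x. g x \<partial>M) epowr b"
  using nn_integral_prod_epowr_le[of "UNIV :: bool set" "\<lambda>i. if i then a else b" "\<lambda>i. if i then f else g" M] assms
  by (simp add: UNIV_bool add.commute mult.commute)

text \<open>With respect to this normalised measure Hoelder's inequality applies to averages
  directly, and no powers of the measure of \<open>B\<close> remain.\<close>

lemma avg_eq_nn_integral:
  assumes "B \<in> sets lebesgue" "g \<in> borel_measurable lebesgue"
  shows "avg B g = (\<integral>\<^sup>+x. g x \<partial>density lebesgue (\<lambda>x. indicator B x / emeasure lebesgue B))"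
proof -
  have "(\<integral>\<^sup>+x. g x \<partial>density lebesgue (\<lambda>x. indicator B x / emeasure lebesgue B))
      = (\<integral>\<^sup>+x. g x * indicator B x / emeasure lebesgue B \<partial>lebesgue)"
    using assms by (subst nn_integral_density) (auto simp: divide_ennreal_def ac_simps)
  also have "\<dots> = avg B g"
    using assms by (subst nn_integral_divide) (auto simp: avg_def)
  finally show ?thesis by simp
qed

lemma avg_eq_0_iff:
  assumes "B \<in> sets lebesgue" "emeasure lebesgue B < top" "g \<in> borel_measurable lebesgue"
  shows "avg B g = 0 \<longleftrightarrow> (AE x in lebesgue. x \<in> B \<longrightarrow> g x = 0)"
proof -
  have "(\<lambda>x. g x * indicator B x) \<in> borel_measurable lebesgue"
    using assms by measurable
  then have "avg B g = 0 \<longleftrightarrow> (AE x in lebesgue. g x * indicator B x = 0)"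
    using less_imp_neq[OF assms(2)] by (simp add: avg_def nn_integral_0_iff_AE)
  also have "\<dots> \<longleftrightarrow> (AE x in lebesgue. x \<in> B \<longrightarrow> g x = 0)"
    by (intro AE_cong) (auto split: split_indicator)
  finally show ?thesis .
qed

lemma avg_neq_top_AE:
  assumes "B \<in> sets lebesgue" "emeasure lebesgue B < top" "g \<in> borel_measurable lebesgue"
    and "avg B g \<noteq> top"
  shows "AE x in lebesgue. x \<in> B \<longrightarrow> g x \<noteq> top"
proof -
  have m: "(\<lambda>x. g x * indicator B x) \<in> borel_measurable lebesgue"
    using assms by measurable
  have "(\<integral>\<^sup>+x\<in>B. g x \<partial>lebesgue) \<noteq> \<infinity>"
    using less_imp_neq[OF assms(2)] assms(4) by (auto simp: avg_def ennreal_divide_eq_top_iff)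
  from nn_integral_noteq_infinite[OF m this] show ?thesis
    by (rule AE_mp) (auto intro!: AE_I2 split: split_indicator)
qed

text \<open>A negative power of the finite value \<open>w x\<close> is never 0, and it is infinite
  where \<open>w\<close> vanishes. Nonzero averages are needed so that no factor of the bump
  condition can hide an infinite one.\<close>

lemma avg_power_weight_neq_0:
  fixes w :: "real ^ 'n \<Rightarrow> real"
  assumes "B \<in> sets lebesgue" "0 < emeasure lebesgue B" "emeasure lebesgue B < top"
    and [measurable]: "w \<in> borel_measurable lebesgue" and "a < 0"
  shows "avg B (\<lambda>x. ennreal (w x) epowr a) \<noteq> 0"
proof
  assume "avg B (\<lambda>x. ennreal (w x) epowr a) = 0"
  then have "AE x in lebesgue. x \<in> B \<longrightarrow> ennreal (w x) epowr a = 0"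
    using assms by (subst (asm) avg_eq_0_iff) auto
  moreover have "ennreal (w x) epowr a \<noteq> 0" for x
    using \<open>a < 0\<close> by (auto simp: epowr_def ennreal_eq_0_iff)
  ultimately have "AE x in lebesgue. x \<notin> B" by simp
  then have "emeasure lebesgue B = 0"
    using assms(1) by (subst (asm) AE_iff_measurable[OF assms(1)]) auto
  then show False using assms by simp
qed

text \<open>
  With \<open>s = P - (P - 1) / r\<close> this is Hoelder's inequality for the factorisation
  \<open>|f| = (|f|\<^sup>P w)\<^bsup>1/P\<^esup> w\<^bsup>-1/P\<^esup>\<close>
  and the exponents \<open>P / s\<close> and \<open>r P / (P - 1)\<close>.
\<close>

lemma avg_le_bump:
  fixes f w :: "real ^ 'n \<Rightarrow> real"
  assumes P: "1 < P" and r: "1 < r" and s: "s = P - (P - 1) / r"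
    and f[measurable]: "f \<in> borel_measurable lebesgue"
    and w[measurable]: "w \<in> borel_measurable lebesgue" and w0: "\<And>x. 0 \<le> w x"
    and B[measurable]: "B \<in> sets lebesgue" and fin: "emeasure lebesgue B < top"
    and W: "avg B (\<lambda>x. ennreal (w x) epowr ((1 - conj_exp P) * r)) \<noteq> top"
  shows "avg B (\<lambda>x. ennreal \<bar>f x\<bar>)
    \<le> avg B (\<lambda>x. ennreal \<bar>\<bar>f x\<bar> powr (P / s) * w x powr (1 / s)\<bar>) epowr (s / P)
       * avg B (\<lambda>x. ennreal (w x) epowr ((1 - conj_exp P) * r)) epowr (1 / (r * conj_exp P))"
proof -
  define N where "N = density lebesgue (\<lambda>x. indicator B x / emeasure lebesgue B)"
  define g where "g x = ennreal \<bar>\<bar>f x\<bar> powr (P / s) * w x powr (1 / s)\<bar>" for x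
  define h where "h x = ennreal (w x) epowr ((1 - conj_exp P) * r)" for x
  have [measurable]: "g \<in> borel_measurable lebesgue" "h \<in> borel_measurable lebesgue"
    unfolding g_def h_def by measurable
  have [measurable]: "g \<in> borel_measurable N" "h \<in> borel_measurable N"
    by (auto simp: N_def)
  have "(P - 1) / r < P - 1" using P r by (simp add: divide_less_eq)
  then have s0: "0 < s" "1 < s" using P s by auto
  have u: "1 / (r * conj_exp P) = (P - 1) / (r * P)" using P by (simp add: conj_exp_def)
  have e: "(1 - conj_exp P) * r = - (r / (P - 1))" using P by (simp add: conj_exp_def field_simps)
  have u0: "0 < 1 / (r * conj_exp P)" unfolding u using P r by simp
  \<comment> \<open>The value of \<open>s\<close> is chosen to make these two exponents add up to
    1.\<close>
  have sum1: "s / P + 1 / (r * conj_exp P) = 1"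
    unfolding u s using P r by (simp add: field_simps)
  \<comment> \<open>Where \<open>w x = 0\<close>, the factor \<open>g x\<close> is 0 while
    \<open>h x\<close> is infinite, and the factorisation may fail. Finiteness of the average of
    \<open>h\<close> makes such points a null subset of \<open>B\<close>.\<close>
  have point: "ennreal \<bar>f x\<bar> = g x epowr (s / P) * h x epowr (1 / (r * conj_exp P))"
    if "h x \<noteq> top" for x
  proof -
    have wx: "0 < w x"
    proof (rule ccontr)
      assume "\<not> 0 < w x"
      then have "w x = 0" using w0[of x] by simp
      moreover have "0 < r / (P - 1)" using P r by simp
      ultimately have "h x = top" unfolding h_def e by (auto simp: epowr_def)
      then show False using that by simp
    qed
    have "g x epowr (s / P) = ennreal ((\<bar>f x\<bar> powr (P / s) * w x powr (1 / s)) powr (s / P))"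
      unfolding g_def using P s0 wx by (subst epowr_ennreal_nonneg) auto
    also have "(\<bar>f x\<bar> powr (P / s) * w x powr (1 / s)) powr (s / P) = \<bar>f x\<bar> * w x powr (1 / P)"
      using P s0 by (simp add: powr_mult powr_powr)
    finally have 1: "g x epowr (s / P) = ennreal (\<bar>f x\<bar> * w x powr (1 / P))" .
    have "h x epowr (1 / (r * conj_exp P)) = ennreal (w x powr (- (r / (P - 1)) * ((P - 1) / (r * P))))"
      unfolding h_def e u using wx by (simp add: epowr_ennreal powr_powr)
    also have "- (r / (P - 1)) * ((P - 1) / (r * P)) = - (1 / P)"
      using P r by (simp add: field_simps)
    finally have 2: "h x epowr (1 / (r * conj_exp P)) = ennreal (w x powr (- (1 / P)))" .
    show ?thesis
      unfolding 1 2 using wx by (simp add: powr_minus field_simps flip: ennreal_mult)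
  qed
  have "AE x in lebesgue. x \<in> B \<longrightarrow> h x \<noteq> top"
    using W unfolding h_def[symmetric] by (intro avg_neq_top_AE B fin) measurable
  then have ae: "AE x in N. h x \<noteq> top"
    unfolding N_def by (subst AE_density) (auto split: split_indicator)
  have "avg B (\<lambda>x. ennreal \<bar>f x\<bar>) = (\<integral>\<^sup>+x. ennreal \<bar>f x\<bar> \<partial>N)"
    unfolding N_def by (rule avg_eq_nn_integral) auto
  also have "\<dots> = (\<integral>\<^sup>+x. g x epowr (s / P) * h x epowr (1 / (r * conj_exp P)) \<partial>N)"
    using ae by (intro nn_integral_cong_AE) (auto simp: point)
  also have "\<dots> \<le> (\<integral>\<^sup>+x. g x \<partial>N) epowr (s / P) * (\<integral>\<^sup>+x. h x \<partial>N) epowr (1 / (r * conj_exp P))"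
    using P s0 u0 sum1 by (intro nn_integral_mult_epowr_le) auto
  also have "(\<integral>\<^sup>+x. g x \<partial>N) = avg B g"
    unfolding N_def by (rule avg_eq_nn_integral[symmetric]) auto
  also have "(\<integral>\<^sup>+x. h x \<partial>N) = avg B h"
    unfolding N_def by (rule avg_eq_nn_integral[symmetric]) auto
  finally show ?thesis unfolding g_def h_def .
qed

section \<open>The estimate for a single set of the basis\<close>

lemma wmeas_eq_avg:
  assumes "0 < emeasure lebesgue B" "emeasure lebesgue B < top"
  shows "wmeas v B = emeasure lebesgue B * avg B (\<lambda>x. ennreal (v x))"
  using assms
  by (simp add: wmeas_def avg_def ennreal_times_divide mult_divide_eq_ennreal
        mult.commute[of "emeasure lebesgue B"] less_top)

text \<open>Read with \<open>a\<close> as the modulus of \<open>f x\<close> and \<open>b\<close> as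
  \<open>w x\<close>, this explains the exponents of the auxiliary function: its unweighted integral
  with power \<open>s\<close> is the weighted integral of \<open>f\<close> with power
  \<open>P\<close>.\<close>

lemma ennreal_powr_epowr_weight:
  fixes a b :: real
  assumes "0 < P" "0 < s" "0 \<le> a" "0 \<le> b"
  shows "ennreal \<bar>a powr (P / s) * b powr (1 / s)\<bar> epowr s = ennreal a epowr P * ennreal b"
  using assms
  by (simp add: epowr_ennreal_nonneg epowr_mult powr_powr ennreal_mult)

text \<open>Hoelder's inequality on \<open>B\<close> for each function produces the factors of the
  bump condition, which \<open>K\<close> absorbs; the remaining power \<open>1 / p\<close> of the
  measure of \<open>B\<close> is shared out as the powers \<open>1 / ps i\<close>.\<close>

lemma bump_le_product:
  fixes w :: "nat \<Rightarrow> real ^ 'n \<Rightarrow> real" and v :: "real ^ 'n \<Rightarrow> real"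
  assumes ps: "\<And>i. i \<in> {1..m} \<Longrightarrow> 1 < ps i" and p: "1 / p = (\<Sum>i=1..m. 1 / ps i)"
    and q: "0 < q" and r: "1 < r"
    and s: "\<And>i. s i = ps i - (ps i - 1) / r"
    and B[measurable]: "B \<in> sets lebesgue"
    and Bpos: "0 < emeasure lebesgue B" and Bfin: "emeasure lebesgue B < top"
    and w: "\<And>i. i \<in> {1..m} \<Longrightarrow> w i \<in> borel_measurable lebesgue"
      "\<And>i x. i \<in> {1..m} \<Longrightarrow> 0 \<le> w i x"
    and f: "\<And>i. i \<in> {1..m} \<Longrightarrow> f i \<in> borel_measurable lebesgue"
    and v: "wmeas v B \<noteq> 0"
    and K: "(emeasure lebesgue B epowr (t + 1 / q - 1 / p)) *
            (avg B (\<lambda>x. ennreal (v x)) epowr (1 / q)) *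
            (\<Prod>i=1..m. avg B (\<lambda>x. ennreal (w i x) epowr ((1 - conj_exp (ps i)) * r))
                epowr (1 / (r * conj_exp (ps i)))) \<le> K" "K < top"
  shows "(emeasure lebesgue B epowr t * (\<Prod>i=1..m. avg B (\<lambda>y. ennreal \<bar>f i y\<bar>))) epowr q * wmeas v B
    \<le> K epowr q * (\<Prod>i=1..m. (emeasure lebesgue B *
        avg B (\<lambda>x. ennreal \<bar>\<bar>f i x\<bar> powr (ps i / s i) * w i x powr (1 / s i)\<bar>) epowr s i) epowr (q / ps i))"
proof -
  define b where "b = emeasure lebesgue B"
  define V where "V = avg B (\<lambda>x. ennreal (v x))"
  define W where "W i = avg B (\<lambda>x. ennreal (w i x) epowr ((1 - conj_exp (ps i)) * r))" for i
  define u where "u i = 1 / (r * conj_exp (ps i))" for i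
  define A where "A i = avg B (\<lambda>x. ennreal \<bar>\<bar>f i x\<bar> powr (ps i / s i) * w i x powr (1 / s i)\<bar>)" for i
  have b: "b \<noteq> 0" "b \<noteq> top" using Bpos Bfin by (auto simp: b_def)
  have vB: "wmeas v B = b * V"
    unfolding b_def V_def by (rule wmeas_eq_avg[OF Bpos Bfin])
  then have V: "V \<noteq> 0" using v by auto
  have s0: "0 < s i" if "i \<in> {1..m}" for i
  proof -
    have "(ps i - 1) / r < ps i - 1" using ps[OF that] r by (simp add: divide_less_eq)
    then show ?thesis using ps[OF that] by (simp add: s)
  qed
  have u: "0 < u i" if "i \<in> {1..m}" for i
    using ps[OF that] r by (simp add: u_def conj_exp_def)
  have K': "b epowr (t + 1 / q - 1 / p) * V epowr (1 / q) * (\<Prod>i=1..m. W i epowr u i) \<le> K"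
    using K(1) by (simp only: b_def V_def W_def u_def)
  have W0: "W i \<noteq> 0" if i: "i \<in> {1..m}" for i
    unfolding W_def
  proof (rule avg_power_weight_neq_0[OF B Bpos Bfin w(1)[OF i]])
    have "1 - conj_exp (ps i) < 0"
      using ps[OF i] by (simp add: conj_exp_def less_divide_eq)
    then show "(1 - conj_exp (ps i)) * r < 0"
      using r by (simp add: mult_neg_pos)
  qed
  have bexp: "b epowr e \<noteq> 0" for e
    using b by (cases b rule: ennreal_cases_pos) (auto simp: epowr_ennreal)
  \<comment> \<open>Since \<open>wmeas v B\<close> is nonzero, no factor of the bump expression
    vanishes, so an infinite \<open>W i\<close> would make it infinite, against
    \<open>K < top\<close>.\<close>
  have Wtop: "W i \<noteq> top" if i: "i \<in> {1..m}" for i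
  proof
    assume "W i = top"
    then have "(\<Prod>i=1..m. W i epowr u i) = top"
      using i W0 u by (auto simp: ennreal_prod_eq_top)
    moreover have "b epowr (t + 1 / q - 1 / p) * V epowr (1 / q) \<noteq> 0"
      using bexp V q by simp
    ultimately have "b epowr (t + 1 / q - 1 / p) * V epowr (1 / q) * (\<Prod>i=1..m. W i epowr u i) = top"
      by (simp only: ennreal_mult_top if_False)
    then show False using K' K(2) by (simp add: top_unique)
  qed
  have avg_le: "avg B (\<lambda>y. ennreal \<bar>f i y\<bar>) \<le> A i epowr (s i / ps i) * W i epowr u i" if i: "i \<in> {1..m}" for i
    unfolding A_def W_def u_def
    using Wtop[OF i, unfolded W_def]
    by (intro avg_le_bump[OF ps[OF i] r s f[OF i] w(1)[OF i] w(2)[OF i] B Bfin])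
  have split_b: "b epowr t * b epowr (1 / q) = b epowr (1 / p) * b epowr (t + 1 / q - 1 / p)"
    using b by (simp flip: epowr_add)
  \<comment> \<open>The weighted measure of \<open>B\<close> is taken under the power
    \<open>q\<close> through its q-th root.\<close>
  have "(b epowr t * (\<Prod>i=1..m. avg B (\<lambda>y. ennreal \<bar>f i y\<bar>))) epowr q * (b * V)
      = (b epowr t * (\<Prod>i=1..m. avg B (\<lambda>y. ennreal \<bar>f i y\<bar>)) * (b epowr (1 / q) * V epowr (1 / q))) epowr q"
    using q by (simp add: epowr_mult epowr_epowr)
  also have "\<dots> \<le> (b epowr t * (\<Prod>i=1..m. A i epowr (s i / ps i) * W i epowr u i)
      * (b epowr (1 / q) * V epowr (1 / q))) epowr q"
    using q avg_le by (intro epowr_mono mult_right_mono mult_left_mono prod_mono_ennreal) auto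
  also have "b epowr t * (\<Prod>i=1..m. A i epowr (s i / ps i) * W i epowr u i)
      * (b epowr (1 / q) * V epowr (1 / q))
      = (b epowr t * b epowr (1 / q)) * V epowr (1 / q) * (\<Prod>i=1..m. W i epowr u i)
         * (\<Prod>i=1..m. A i epowr (s i / ps i))"
    by (simp only: prod.distrib ac_simps)
  also have "\<dots> = (b epowr (t + 1 / q - 1 / p) * V epowr (1 / q) * (\<Prod>i=1..m. W i epowr u i))
         * (b epowr (1 / p) * (\<Prod>i=1..m. A i epowr (s i / ps i)))"
    unfolding split_b by (simp only: ac_simps)
  also have "b epowr (1 / p) * (\<Prod>i=1..m. A i epowr (s i / ps i))
      = (\<Prod>i=1..m. (b * A i epowr s i) epowr (1 / ps i))"
  proof -
    have "(b * A i epowr s i) epowr (1 / ps i) = b epowr (1 / ps i) * A i epowr (s i / ps i)"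
      if "i \<in> {1..m}" for i
      using ps[OF that] s0[OF that] by (simp add: epowr_mult epowr_epowr)
    then show ?thesis
      unfolding p epowr_sum[OF b] prod.distrib[symmetric] by (intro prod.cong) auto
  qed
  also have "((b epowr (t + 1 / q - 1 / p) * V epowr (1 / q) * (\<Prod>i=1..m. W i epowr u i))
      * (\<Prod>i=1..m. (b * A i epowr s i) epowr (1 / ps i))) epowr q
     \<le> (K * (\<Prod>i=1..m. (b * A i epowr s i) epowr (1 / ps i))) epowr q"
    using q by (intro epowr_mono mult_right_mono K') auto
  also have "\<dots> = K epowr q * (\<Prod>i=1..m. (b * A i epowr s i) epowr (q / ps i))"
  proof -
    have "((b * A i epowr s i) epowr (1 / ps i)) epowr q = (b * A i epowr s i) epowr (q / ps i)"
      if "i \<in> {1..m}" for i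
      using ps[OF that] q by (simp add: epowr_epowr)
    then show ?thesis
      using q by (simp add: epowr_mult epowr_prod)
  qed
  finally show ?thesis
    unfolding vB by (simp only: A_def b_def)
qed

section \<open>Boundedness of the multilinear fractional maximal operator\<close>

theorem corollary2p7:
  fixes \<B> :: "(real ^ 'n) set set"
    and m :: nat
    and \<alpha> p q r \<gamma> :: real
    and ps :: "nat \<Rightarrow> real"
    and w :: "nat \<Rightarrow> real ^ 'n \<Rightarrow> real"
    and v :: "real ^ 'n \<Rightarrow> real"
  assumes "0 \<le> \<alpha>" and "\<alpha> < real m * real CARD('n)"
    and "\<And>i. i \<in> {1..m} \<Longrightarrow> 1 < ps i"
    and "1 / p = (\<Sum>i=1..m. 1 / ps i)"
    and "0 < p" and "p \<le> q"
    and "muckenhoupt_basis \<B>"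
    and "\<And>i. i \<in> {1..m} \<Longrightarrow> weight \<B> (w i)"
    and "weight \<B> v"
    and "0 < \<gamma>" and "\<gamma> < 1" and "tauberian \<B> \<gamma> v"
    and "1 < r"
    and "(SUP B\<in>\<B>.
            (emeasure lebesgue B epowr (\<alpha> / real CARD('n) + 1 / q - 1 / p)) *
            (avg B (\<lambda>x. ennreal (v x)) epowr (1 / q)) *
            (\<Prod>i=1..m. avg B (\<lambda>x. ennreal (w i x) epowr ((1 - conj_exp (ps i)) * r))
                epowr (1 / (r * conj_exp (ps i))))) < \<infinity>"
  shows "\<exists>C>0. \<forall>f :: nat \<Rightarrow> real ^ 'n \<Rightarrow> real.
           (\<forall>i\<in>{1..m}. f i \<in> borel_measurable lebesgue) \<longrightarrow>
           wnorm q v (frac_maximal \<B> \<alpha> m f)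
             \<le> ennreal C * (\<Prod>i=1..m. wnorm (ps i) (w i) (\<lambda>x. ennreal \<bar>f i x\<bar>))"
proof -
  note ps = assms(3) and p = assms(4) and \<gamma> = assms(10,11) and r = assms(13)
  have q: "0 < q" using assms(5,6) by simp
  have basis: "is_basis \<B>" using assms(7) by (simp add: muckenhoupt_basis_def)
  note B = is_basisD[OF basis]
  define t where "t = \<alpha> / real CARD('n)"
  define s where "s i = ps i - (ps i - 1) / r" for i
  have s1: "1 < s i" if "i \<in> {1..m}" for i
  proof -
    have "(ps i - 1) / r < ps i - 1" using ps[OF that] r by (simp add: divide_less_eq)
    then show ?thesis by (simp add: s_def)
  qed
  have w: "w i \<in> borel_measurable lebesgue" "0 \<le> w i x" if "i \<in> {1..m}" for i x
    using assms(8)[OF that] by (auto simp: weight_def)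
  have v[measurable]: "v \<in> borel_measurable lebesgue"
    using assms(9) by (simp add: weight_def)
  obtain T where T: "\<And>E. E \<in> sets lebesgue \<Longrightarrow>
      wmeas v {x. maximal \<B> (indicator E) x > ennreal \<gamma>} \<le> ennreal T * wmeas v E"
    using assms(12) unfolding tauberian_def by blast
  define K where "K = (SUP B\<in>\<B>.
            (emeasure lebesgue B epowr (t + 1 / q - 1 / p)) *
            (avg B (\<lambda>x. ennreal (v x)) epowr (1 / q)) *
            (\<Prod>i=1..m. avg B (\<lambda>x. ennreal (w i x) epowr ((1 - conj_exp (ps i)) * r))
                epowr (1 / (r * conj_exp (ps i)))))"
  have Ktop: "K < top" using assms(14) by (simp add: K_def t_def)
  have "\<exists>C<top. \<forall>f \<in> borel_measurable lebesgue.
       (\<integral>\<^sup>+x. maximal \<B> f x epowr s i \<partial>lebesgue) \<le> C * (\<integral>\<^sup>+x. ennreal \<bar>f x\<bar> epowr s i \<partial>lebesgue)"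
    if "i \<in> {1..m}" for i
    using muckenhoupt_basis_unweighted[OF assms(7) s1[OF that]] by metis
  then obtain D where D: "\<And>i. i \<in> {1..m} \<Longrightarrow> D i < top"
      "\<And>i f. i \<in> {1..m} \<Longrightarrow> f \<in> borel_measurable lebesgue \<Longrightarrow>
       (\<integral>\<^sup>+x. maximal \<B> f x epowr s i \<partial>lebesgue) \<le> D i * (\<integral>\<^sup>+x. ennreal \<bar>f x\<bar> epowr s i \<partial>lebesgue)"
    by metis
  \<comment> \<open>The factor \<open>1 / (1 - \<gamma>)\<close> pays for the passage from
    \<open>B\<close> to its part \<open>E B\<close>.\<close>
  define D' where "D' i = ennreal (1 / (1 - \<gamma>)) * D i" for i
  define C where "C = ennreal T epowr (1 / q) * K * (\<Prod>i=1..m. D' i epowr (1 / ps i))"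
  have C: "C < top"
  proof -
    have "D' i epowr (1 / ps i) \<noteq> top" if "i \<in> {1..m}" for i
      using D(1)[OF that] ps[OF that] by (simp add: D'_def ennreal_mult_eq_top_iff)
    then have "(\<Prod>i=1..m. D' i epowr (1 / ps i)) \<noteq> top"
      by (auto simp: ennreal_prod_eq_top)
    then show ?thesis
      using Ktop q by (auto simp: C_def ennreal_mult_eq_top_iff less_top[symmetric])
  qed
  have main: "wnorm q v (frac_maximal \<B> \<alpha> m f) \<le> C * (\<Prod>i=1..m. wnorm (ps i) (w i) (\<lambda>x. ennreal \<bar>f i x\<bar>))"
    if f: "\<forall>i\<in>{1..m}. f i \<in> borel_measurable lebesgue" for f
  proof -
    define c where "c B = emeasure lebesgue B epowr t * (\<Prod>i=1..m. avg B (\<lambda>y. ennreal \<bar>f i y\<bar>))" for B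
    define g where "g i x = \<bar>f i x\<bar> powr (ps i / s i) * w i x powr (1 / s i)" for i x
    define X where "X i = (\<integral>\<^sup>+x. (ennreal \<bar>f i x\<bar> epowr ps i) * ennreal (w i x) \<partial>lebesgue)" for i
    \<comment> \<open>Chosen so that \<open>R epowr (1 / q)\<close> is \<open>C\<close> times the
      product of the weighted norms.\<close>
    define R where "R = ennreal T * (K epowr q * (\<Prod>i=1..m. (D' i * X i) epowr (q / ps i)))"
    have fin: "(\<integral>\<^sup>+x. (SUP B\<in>{B\<in>F. x \<in> B}. c B epowr q) * ennreal (v x) \<partial>lebesgue) \<le> R"
      if F: "finite F" "F \<subseteq> \<B>" for F
    proof -
      obtain S E where S: "S \<subseteq> F" and disj: "disjoint_family_on E S"
        and E: "\<And>B. B \<in> S \<Longrightarrow> E B \<in> sets lebesgue \<and> E B \<subseteq> B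
             \<and> ennreal (1 - \<gamma>) * emeasure lebesgue B \<le> emeasure lebesgue (E B)"
        and le: "(\<integral>\<^sup>+x. (SUP B\<in>{B\<in>F. x \<in> B}. c B epowr q) * ennreal (v x) \<partial>lebesgue)
           \<le> ennreal T * (\<Sum>B\<in>S. c B epowr q * wmeas v B)"
        using finite_sparse_domination[OF basis v \<gamma> T F, of "\<lambda>B. c B epowr q"] by blast
      \<comment> \<open>Sets that are null for \<open>v\<close> contribute 0 even if
        \<open>c B\<close> is infinite; they are set aside because the bump condition gives no
        control of the \<open>w i\<close> on them.\<close>
      define S' where "S' = {B\<in>S. wmeas v B \<noteq> 0}"
      have S': "finite S'" "S' \<subseteq> S" "S' \<subseteq> \<B>"
        using S F finite_subset[of S F] by (auto simp: S'_def)
      define Q where "Q i B = emeasure lebesgue B * avg B (\<lambda>x. ennreal \<bar>g i x\<bar>) epowr s i" for i B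
      have "(\<Sum>B\<in>S. c B epowr q * wmeas v B) = (\<Sum>B\<in>S'. c B epowr q * wmeas v B)"
        using S F finite_subset[of S F] unfolding S'_def by (intro sum.mono_neutral_right) auto
      also have "\<dots> \<le> (\<Sum>B\<in>S'. K epowr q * (\<Prod>i=1..m. Q i B epowr (q / ps i)))"
      proof (rule sum_mono)
        fix A assume A: "A \<in> S'"
        then have AB: "A \<in> \<B>" and vA: "wmeas v A \<noteq> 0" using S' by (auto simp: S'_def)
        then have ne: "A \<noteq> {}" by (auto simp: wmeas_def)
        show "c A epowr q * wmeas v A \<le> K epowr q * (\<Prod>i=1..m. Q i A epowr (q / ps i))"
          unfolding c_def Q_def g_def
        proof (rule bump_le_product[where p = p and r = r])
          show "(emeasure lebesgue A epowr (t + 1 / q - 1 / p)) *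
            (avg A (\<lambda>x. ennreal (v x)) epowr (1 / q)) *
            (\<Prod>i=1..m. avg A (\<lambda>x. ennreal (w i x) epowr ((1 - conj_exp (ps i)) * r))
                epowr (1 / (r * conj_exp (ps i)))) \<le> K"
            unfolding K_def using AB by (rule SUP_upper)
        qed (use ps p q r s_def w f vA Ktop B(2,3)[OF AB] B(4)[OF AB ne] in blast)+
      qed
      also have "\<dots> = K epowr q * (\<Sum>B\<in>S'. \<Prod>i=1..m. Q i B epowr (q / ps i))"
        by (rule sum_distrib_left[symmetric])
      \<comment> \<open>The exponents add up to \<open>q / p\<close>, so here
        \<open>p \<le> q\<close> enters.\<close>
      also have "\<dots> \<le> K epowr q * (\<Prod>i=1..m. (\<Sum>B\<in>S'. Q i B) epowr (q / ps i))"
      proof (intro mult_left_mono sum_prod_epowr_le)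
        show "0 < q / ps i" if "i \<in> {1..m}" for i
          using q ps[OF that] by simp
        have "(\<Sum>i=1..m. q / ps i) = q * (\<Sum>i=1..m. 1 / ps i)"
          by (simp add: sum_distrib_left)
        also have "\<dots> = q / p" unfolding p[symmetric] by simp
        finally show "1 \<le> (\<Sum>i=1..m. q / ps i)"
          using assms(5,6) by simp
      qed (use S' in auto)
      also have "\<dots> \<le> K epowr q * (\<Prod>i=1..m. (D' i * X i) epowr (q / ps i))"
      proof (intro mult_left_mono prod_mono_ennreal epowr_mono)
        fix i assume i: "i \<in> {1..m}"
        show "0 \<le> q / ps i" using q ps[OF i] by simp
        have [measurable]: "f i \<in> borel_measurable lebesgue" "w i \<in> borel_measurable lebesgue"
          using f i w(1)[OF i] by auto
        have gm: "g i \<in> borel_measurable lebesgue"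
          unfolding g_def by measurable
        have "ennreal (1 - \<gamma>) * (\<Sum>B\<in>S'. Q i B) \<le> (\<integral>\<^sup>+x. maximal \<B> (g i) x epowr s i \<partial>lebesgue)"
          unfolding Q_def
        proof (rule sparse_sum_le_maximal[where E = E])
          show "disjoint_family_on E S'"
            using disj S'(2) by (rule disjoint_family_on_mono[rotated])
        qed (use S' s1[OF i] E in auto)
        also have "\<dots> \<le> D i * (\<integral>\<^sup>+x. ennreal \<bar>g i x\<bar> epowr s i \<partial>lebesgue)"
          by (rule D(2)[OF i gm])
        also have "(\<integral>\<^sup>+x. ennreal \<bar>g i x\<bar> epowr s i \<partial>lebesgue) = X i"
          unfolding g_def X_def using ps[OF i] s1[OF i] w(2)[OF i]
          by (subst ennreal_powr_epowr_weight) auto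
        finally have "ennreal (1 / (1 - \<gamma>)) * (ennreal (1 - \<gamma>) * (\<Sum>B\<in>S'. Q i B))
            \<le> ennreal (1 / (1 - \<gamma>)) * (D i * X i)"
          by (rule mult_left_mono) simp
        moreover have "ennreal (1 / (1 - \<gamma>)) * ennreal (1 - \<gamma>) = 1"
          using \<gamma> by (simp flip: ennreal_mult)
        ultimately show "(\<Sum>B\<in>S'. Q i B) \<le> D' i * X i"
          by (simp add: D'_def flip: mult.assoc)
      qed simp
      finally have "ennreal T * (\<Sum>B\<in>S. c B epowr q * wmeas v B) \<le> R"
        unfolding R_def by (rule mult_left_mono) simp
      with le show ?thesis by (rule order_trans)
    qed
    \<comment> \<open>The power is moved inside the supremum, so that the functional of a set
      becomes \<open>c B epowr q\<close>.\<close>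
    have frac_le: "frac_maximal \<B> \<alpha> m f x epowr q \<le> (SUP B\<in>{B\<in>\<B>. x \<in> B}. c B epowr q)" for x
      unfolding epowr_le_iff[OF q] frac_maximal_def t_def[symmetric] c_def[symmetric]
    proof (rule SUP_least)
      fix A assume "A \<in> {B\<in>\<B>. x \<in> B}"
      then show "c A \<le> (SUP B\<in>{B\<in>\<B>. x \<in> B}. c B epowr q) epowr (1 / q)"
        unfolding epowr_le_iff[OF q, symmetric] by (rule SUP_upper)
    qed
    have "(\<integral>\<^sup>+x. (frac_maximal \<B> \<alpha> m f x epowr q) * ennreal (v x) \<partial>lebesgue)
        \<le> (\<integral>\<^sup>+x. (SUP B\<in>{B\<in>\<B>. x \<in> B}. c B epowr q) * ennreal (v x) \<partial>lebesgue)"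
      by (intro nn_integral_mono mult_right_mono frac_le) simp
    also have "\<dots> \<le> R"
      by (rule nn_integral_SUP_open_le[OF B(1) _ fin]) auto
    finally have "wnorm q v (frac_maximal \<B> \<alpha> m f) \<le> R epowr (1 / q)"
      unfolding wnorm_def using q by (intro epowr_mono) auto
    also have "\<dots> = C * (\<Prod>i=1..m. X i epowr (1 / ps i))"
    proof -
      have "((D' i * X i) epowr (q / ps i)) epowr (1 / q) = D' i epowr (1 / ps i) * X i epowr (1 / ps i)"
        if "i \<in> {1..m}" for i
        using q ps[OF that] by (simp add: epowr_epowr epowr_mult)
      then have "R epowr (1 / q) = ennreal T epowr (1 / q) * (K * (\<Prod>i=1..m. D' i epowr (1 / ps i) * X i epowr (1 / ps i)))"
        unfolding R_def using q by (simp add: epowr_mult epowr_epowr epowr_prod)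
      then show ?thesis
        by (simp only: C_def prod.distrib ac_simps)
    qed
    finally show ?thesis
      unfolding wnorm_def X_def .
  qed
  show ?thesis
  \<comment> \<open>Adding 1 makes the constant positive also when \<open>C = 0\<close>.\<close>
  proof (intro exI[of _ "enn2real C + 1"] conjI allI impI)
    show "0 < enn2real C + 1"
      using enn2real_nonneg[of C] by linarith
    fix f :: "nat \<Rightarrow> real ^ 'n \<Rightarrow> real"
    assume f: "\<forall>i\<in>{1..m}. f i \<in> borel_measurable lebesgue"
    have "C = ennreal (enn2real C)" using C by simp
    also have "\<dots> \<le> ennreal (enn2real C + 1)" by (intro ennreal_leI) simp
    finally show "wnorm q v (frac_maximal \<B> \<alpha> m f)
        \<le> ennreal (enn2real C + 1) * (\<Prod>i=1..m. wnorm (ps i) (w i) (\<lambda>x. ennreal \<bar>f i x\<bar>))"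
      by (intro order_trans[OF main[OF f]] mult_right_mono) auto
  qed
qed

end
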